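(* Let $p_1,p_2>0$ satisfy $p_1+p_2<\frac12$. Then there exists $K>0$ such that if $k\in\mathbb{N}$ with $k\ge K$ and if, writing $k_1=k+\frac12$, the real number $u$ satisfies $$\frac38 k_1^{-2p_2}\le u\le p_2\log k_1,$$ then $$\big\|\Pi_{\sqrt{2k_1}\sinh u,\,k}\big\| = (4\pi k_1\sinh 2u)^{-1/2}\,e^{k_1(2u+\sinh 2u)}\left(1+\mathcal{O}(k_1^{-p_1})\right),$$ where $\mathcal{O}(k_1^{-p_1})$ denotes a quantity bounded in absolute value by $Ck_1^{-p_1}$ for a constant $C>0$ independent of $k$ and $u$ (it may depend on $p_1,p_2$).
   Context: $\mathbb{N}=\{0,1,2,\dots\}$. The Hermite functions are $h_k(y) = (2^k k!\sqrt{\pi})^{-1/2}\left(y-\frac{d}{dy}\right)^k e^{-y^2/2}$, regarded as entire functions of $y$. For $a\in\mathbb{R}$ the shifted harmonic oscillator $P_a=\frac12(-\partial_y^2+(y-ia)^2-1)$ on $L^2(\mathbb{R})$ has compact resolvent and spectrum $\mathbb{N}$; its spectral projection at the eigenvalue $k\in\mathbb{N}$ is the rank-one operator $$\Pi_{a,k}f(y) = \langle f, h_k(\cdot+ia)\rangle_{L^2(\mathbb{R})}\, h_k(y-ia),\qquad \langle f,g\rangle=\int_{\mathbb{R}} f\bar g\,dy,$$ and $\|\Pi_{a,k}\|$ is its operator norm on $L^2(\mathbb{R})$. *)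

theory Defs
  imports "HOL-Complex_Analysis.Complex_Analysis"
begin

text \<open>Hermite functions as entire functions; \<^const>\<open>deriv\<close> is the complex derivative here.\<close>

definition hermite_fun :: "nat \<Rightarrow> complex \<Rightarrow> complex" where
  "hermite_fun k z =
     of_real ((2 ^ k * fact k * sqrt pi) powr (- (1 / 2))) *
     ((\<lambda>g w. w * g w - deriv g w) ^^ k) (\<lambda>w. exp (- (w\<^sup>2 / 2))) z"

text \<open>
  Elements of \<open>L\<^sup>2(\<real>)\<close> are represented by Borel functions, without passing to classes modulo null
  sets: every Lebesgue measurable function agrees almost everywhere with a Borel one.
\<close>

definition L2 :: "(real \<Rightarrow> complex) set" where
  "L2 = {f \<in> borel_measurable lborel. integrable lborel (\<lambda>y. (cmod (f y))\<^sup>2)}"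

definition l2_inner :: "(real \<Rightarrow> complex) \<Rightarrow> (real \<Rightarrow> complex) \<Rightarrow> complex" where
  "l2_inner f g = (LINT y|lborel. f y * cnj (g y))"

definition l2_norm :: "(real \<Rightarrow> complex) \<Rightarrow> real" where
  "l2_norm f = sqrt (LINT y|lborel. (cmod (f y))\<^sup>2)"

text \<open>
  The operator norm, in the form of \<^const>\<open>onorm\<close> (whose type class does not apply to functions).
  As there, the \<open>f\<close> of norm zero contribute the value \<open>0\<close>, and the supremum is meaningful for
  bounded operators from \<open>L\<^sup>2(\<real>)\<close> to itself.
\<close>

definition l2_onorm :: "((real \<Rightarrow> complex) \<Rightarrow> real \<Rightarrow> complex) \<Rightarrow> real" where
  "l2_onorm T = (SUP f\<in>L2. l2_norm (T f) / l2_norm f)"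

text \<open>
  The spectral projection of the shifted harmonic oscillator
  \<open>(- \<partial>\<^sup>2 + (y - \<i> a)\<^sup>2 - 1) / 2\<close> at its eigenvalue \<open>k\<close>, given by its rank-one formula.
\<close>

definition spectral_proj :: "real \<Rightarrow> nat \<Rightarrow> (real \<Rightarrow> complex) \<Rightarrow> real \<Rightarrow> complex" where
  "spectral_proj a k f y =
     l2_inner f (\<lambda>x. hermite_fun k (of_real x + \<i> * of_real a)) *
     hermite_fun k (of_real y - \<i> * of_real a)"

end

theory Submission
  imports Defs "HOL-Probability.Distributions" "HOL-Real_Asymp.Real_Asymp"
begin

text \<open>
  Since \<open>\<Pi>\<^sub>a\<^sub>,\<^sub>k\<close> has rank one, its norm is the squared norm of \<open>h\<^sub>k(\<cdot> + ia)\<close>. Expanding the shifted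
  Hermite polynomial and integrating by parts against the Gaussian gives \<open>exp (x / 2) L\<^sub>k(-x)\<close> with
  the Laguerre polynomial \<open>L\<^sub>k\<close> and \<open>x = 2 a\<^sup>2\<close>, which is \<open>4 k\<^sub>1 (sinh u)\<^sup>2\<close> for
  \<open>a = \<surd>(2 k\<^sub>1) sinh u\<close>. No saddle point analysis is needed: the logarithmic derivative of this
  function satisfies a Riccati equation, and barriers starting at \<open>u = 0\<close> pin it to its WKB
  approximation with error \<open>2 / (k\<^sub>1 sinh (2 u))\<close>. Integrating from \<open>u\<close> to \<open>\<infinity>\<close>, where the leading
  coefficient of \<open>L\<^sub>k\<close> and Stirling's formula give the constant, leaves a relative error of order
  \<open>1 / (k\<^sub>1 u)\<close>, which is at most of order \<open>k\<^sub>1\<close> to the power \<open>2 p\<^sub>2 - 1 < - p\<^sub>1\<close>.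
\<close>

section \<open>The norm of the spectral projections\<close>

fun hermite_poly :: "nat \<Rightarrow> complex poly" where
  "hermite_poly 0 = 1"
| "hermite_poly (Suc k) = [:0, 2:] * hermite_poly k - pderiv (hermite_poly k)"

text \<open>Pulling the Gaussian through \<open>w - d/dw\<close> turns the operator into
  \<open>2w - d/dw\<close> on the polynomial factor, which is the recursion of
  \<open>hermite_poly\<close>.\<close>

lemma hermite_fun_eq:
  "hermite_fun k z = of_real ((2 ^ k * fact k * sqrt pi) powr (- (1 / 2))) *
     (poly (hermite_poly k) z * exp (- (z\<^sup>2 / 2)))"
proof -
  have "((\<lambda>g w. w * g w - deriv g w) ^^ k) (\<lambda>w. exp (- (w\<^sup>2 / 2))) =
      (\<lambda>w. poly (hermite_poly k) w * exp (- (w\<^sup>2 / 2)))"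
  proof (induction k)
    case (Suc k)
    have "deriv (\<lambda>w. poly (hermite_poly k) w * exp (- (w\<^sup>2 / 2))) w =
        poly (pderiv (hermite_poly k)) w * exp (- (w\<^sup>2 / 2)) - w * poly (hermite_poly k) w * exp (- (w\<^sup>2 / 2))" for w
      by (rule DERIV_imp_deriv) (auto intro!: derivative_eq_intros poly_DERIV)
    thus ?case by (simp add: Suc.IH fun_eq_iff algebra_simps)
  qed simp
  thus ?thesis by (simp add: hermite_fun_def)
qed

text \<open>The coefficients are real. This makes |H_k(z)|^2 a product of two polynomials, one
  evaluated at z and one at its conjugate.\<close>

lemma cnj_poly_hermite_poly: "cnj (poly (hermite_poly k) z) = poly (hermite_poly k) (cnj z)"
proof -
  have cd: "map_poly cnj (pderiv p) = pderiv (map_poly cnj p)" for p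
    by (rule poly_eqI) (simp add: coeff_map_poly coeff_pderiv)
  have cm: "map_poly cnj (p * q) = map_poly cnj p * map_poly cnj q" for p q
    by (rule poly_eqI) (simp add: coeff_map_poly coeff_mult)
  have csm: "map_poly cnj (smult c p) = smult (cnj c) (map_poly cnj p)" for c p
    by (rule poly_eqI) (simp add: coeff_map_poly)
  have cs: "map_poly cnj (p - q) = map_poly cnj p - map_poly cnj q" for p q
    by (rule poly_eqI) (simp add: coeff_map_poly)
  have "map_poly cnj (hermite_poly k) = hermite_poly k"
    by (induction k) (simp_all add: cd cm cs csm map_poly_pCons)
  thus ?thesis by (metis poly_cnj)
qed

text \<open>Differentiating the recursion and inserting the induction hypothesis, the last two terms
  recombine into the recursion one index lower.\<close>

lemma pderiv_hermite_poly: "pderiv (hermite_poly (Suc k)) = smult (2 * of_nat (Suc k)) (hermite_poly k)"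
proof (induction k)
  case (Suc k)
  have "pderiv (hermite_poly (Suc (Suc k))) =
      smult 2 (hermite_poly (Suc k)) + [:0, 2:] * pderiv (hermite_poly (Suc k)) - pderiv (pderiv (hermite_poly (Suc k)))"
    by (simp add: pderiv_diff pderiv_mult pderiv_pCons pderiv_smult del: hermite_poly.simps(2) add: hermite_poly.simps(2)[of "Suc k"])
  also have "\<dots> = smult 2 (hermite_poly (Suc k)) + smult (2 * of_nat (Suc k)) (hermite_poly (Suc k))"
    unfolding Suc.IH by (simp add: pderiv_smult smult_diff_right algebra_simps)
  also have "\<dots> = smult (2 * of_nat (Suc (Suc k))) (hermite_poly (Suc k))"
    by (simp add: smult_add_left[symmetric] algebra_simps del: hermite_poly.simps)
  finally show ?case .
qed (simp add: pderiv_diff pderiv_pCons)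

section \<open>Gaussian moments and integration of polynomials against the Gaussian\<close>

definition gauss_moment :: "nat \<Rightarrow> real" where
  "gauss_moment n = (if even n then sqrt pi * (fact n / (2 ^ n * fact (n div 2))) else 0)"

lemma has_bochner_integral_gauss_moment:
  "has_bochner_integral lborel (\<lambda>x. exp (- x\<^sup>2) * x ^ n) (gauss_moment n)"
proof (cases "even n")
  case True
  then obtain m where n: "n = 2 * m" by blast
  from has_bochner_integral_even_function[OF gaussian_moment_even_pos[where k=m]]
  show ?thesis by (simp add: n gauss_moment_def)
next
  case False
  then obtain m where n: "n = 2 * m + 1" using oddE by blast
  from has_bochner_integral_odd_function[OF gaussian_moment_odd_pos[where k=m]]
  show ?thesis by (simp add: n gauss_moment_def)
qed

text \<open>Integration by parts at the level of moments. For \<open>n = 0\<close> the truncated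
  \<open>n - 1\<close> does no harm, as its factor is 0.\<close>

lemma gauss_moment_Suc: "2 * gauss_moment (Suc n) = real n * gauss_moment (n - 1)"
proof (cases "even n")
  case True
  thus ?thesis by (cases n) (auto simp: gauss_moment_def)
next
  case False
  then obtain m where n: "n = 2 * m + 1" using oddE by blast
  define s where "s = real m + 1"
  have s: "s > 0" by (simp add: s_def)
  have "fact (2 * m + 2) = 2 * s * (2 * real m + 1) * fact (2 * m)"
    by (simp add: s_def algebra_simps)
  moreover have "fact (Suc m) = s * fact m" by (simp add: s_def)
  moreover have "(2::real) ^ (2 * m + 2) = 4 * 2 ^ (2 * m)" by (simp add: power_add)
  ultimately have "gauss_moment (2 * m + 2) =
      sqrt pi * ((2 * s * (2 * real m + 1) * fact (2 * m)) / (4 * 2 ^ (2 * m) * (s * fact m)))"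
    by (simp add: gauss_moment_def del: fact_Suc)
  also have "\<dots> = (2 * real m + 1) / 2 * gauss_moment (2 * m)"
    using s by (simp add: gauss_moment_def field_simps)
  finally have "2 * gauss_moment (2 * m + 2) = (2 * real m + 1) * gauss_moment (2 * m)"
    by (simp add: field_simps)
  thus ?thesis by (simp add: n add.commute)
qed

definition gauss_integral :: "complex poly \<Rightarrow> complex" where
  "gauss_integral p = (LINT y|lborel. poly p (of_real y) * of_real (exp (- y\<^sup>2)))"

lemma has_bochner_integral_gauss_monom:
  fixes c :: complex
  shows
  "has_bochner_integral lborel (\<lambda>y. poly (monom c n) (of_real y) * of_real (exp (- y\<^sup>2)))
     (c * of_real (gauss_moment n))"
proof -
  have "has_bochner_integral lborel (\<lambda>y. c * of_real (exp (- y\<^sup>2) * y ^ n)) (c * of_real (gauss_moment n))"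
    by (intro has_bochner_integral_mult_right
      has_bochner_integral_bounded_linear[OF bounded_linear_of_real] has_bochner_integral_gauss_moment)
  thus ?thesis by (simp add: poly_monom algebra_simps)
qed

lemma integrable_gauss_poly:
  fixes p :: "complex poly"
  shows
  "integrable lborel (\<lambda>y. poly p (of_real y) * of_real (exp (- y\<^sup>2)))"
proof -
  have "integrable lborel (\<lambda>y. \<Sum>i\<le>degree p. poly (monom (coeff p i) i) (of_real y) * of_real (exp (- y\<^sup>2)))"
    by (intro Bochner_Integration.integrable_sum integrable.intros[OF has_bochner_integral_gauss_monom])
  moreover have "poly p z = (\<Sum>i\<le>degree p. poly (monom (coeff p i) i) z)" for z
    by (subst poly_as_sum_of_monoms[of p, symmetric]) (simp only: poly_sum)
  ultimately show ?thesis by (simp add: sum_distrib_right)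
qed

lemma gauss_integral_add: "gauss_integral (p + q) = gauss_integral p + gauss_integral q"
  unfolding gauss_integral_def
  by (subst Bochner_Integration.integral_add[symmetric])
     (simp_all only: integrable_gauss_poly poly_add distrib_right)

lemma gauss_integral_diff: "gauss_integral (p - q) = gauss_integral p - gauss_integral q"
  unfolding gauss_integral_def
  by (subst Bochner_Integration.integral_diff[symmetric])
     (simp_all only: integrable_gauss_poly poly_diff left_diff_distrib)

lemma gauss_integral_smult: "gauss_integral (smult c p) = c * gauss_integral p"
  unfolding gauss_integral_def by (simp add: mult.assoc)

lemma gauss_integral_0: "gauss_integral 0 = 0"
  by (simp add: gauss_integral_def)

lemma gauss_integral_sum: "gauss_integral (\<Sum>i\<in>A. f i) = (\<Sum>i\<in>A. gauss_integral (f i))"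
  by (induction A rule: infinite_finite_induct) (simp_all add: gauss_integral_0 gauss_integral_add)

lemma gauss_integral_monom: "gauss_integral (monom c n) = c * of_real (gauss_moment n)"
  unfolding gauss_integral_def
  by (rule has_bochner_integral_integral_eq) (rule has_bochner_integral_gauss_monom)

lemma gauss_integral_1: "gauss_integral 1 = of_real (sqrt pi)"
  using gauss_integral_monom[of 1 0] by (simp add: gauss_moment_def)

lemma pderiv_sum: "pderiv (\<Sum>i\<in>A. f i) = (\<Sum>i\<in>A. pderiv (f i))"
  by (induction A rule: infinite_finite_induct) (simp_all add: pderiv_add)

text \<open>By linearity monomials suffice, and for them this is the moment recursion.\<close>

lemma gauss_integral_by_parts: "gauss_integral ([:0, 2:] * p) = gauss_integral (pderiv p)"
proof -
  have monom: "gauss_integral ([:0, 2:] * monom c n) = gauss_integral (pderiv (monom c n))" for c n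
  proof -
    have "[:0, 2:] * monom c n = monom (2 * c) (Suc n)"
      by (simp add: monom_Suc smult_monom)
    hence "gauss_integral ([:0, 2:] * monom c n) = c * of_real (2 * gauss_moment (Suc n))"
      by (simp add: gauss_integral_monom)
    thus ?thesis
      unfolding gauss_moment_Suc by (simp add: pderiv_monom gauss_integral_monom)
  qed
  have "[:0, 2:] * p = (\<Sum>i\<le>degree p. [:0, 2:] * monom (coeff p i) i)"
    unfolding sum_distrib_left[symmetric] by (simp add: poly_as_sum_of_monoms)
  moreover have "pderiv p = (\<Sum>i\<le>degree p. pderiv (monom (coeff p i) i))"
    by (subst poly_as_sum_of_monoms[of p, symmetric]) (rule pderiv_sum)
  ultimately show ?thesis
    by (metis (no_types, lifting) gauss_integral_sum monom sum.cong)
qed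

text \<open>Each factor \<open>2y - d/dy\<close> that builds \<open>hermite_poly j\<close> becomes,
  by parts, one derivative on the other factor. Orthogonality of H_j to polynomials of lower degree
  is contained in this.\<close>

lemma gauss_integral_hermite_mult:
  "gauss_integral (hermite_poly j * p) = gauss_integral ((pderiv ^^ j) p)"
proof (induction j arbitrary: p)
  case (Suc j)
  have "gauss_integral ([:0, 2:] * (hermite_poly j * p)) =
      gauss_integral (pderiv (hermite_poly j) * p + hermite_poly j * pderiv p)"
    unfolding gauss_integral_by_parts by (simp add: pderiv_mult algebra_simps)
  hence "gauss_integral ([:0, 2:] * (hermite_poly j * p)) - gauss_integral (pderiv (hermite_poly j) * p) =
      gauss_integral (hermite_poly j * pderiv p)"
    unfolding gauss_integral_add by simp
  hence "gauss_integral (hermite_poly (Suc j) * p) = gauss_integral (hermite_poly j * pderiv p)"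
    unfolding gauss_integral_diff[symmetric] by (simp add: algebra_simps)
  also have "\<dots> = gauss_integral ((pderiv ^^ Suc j) p)"
    unfolding Suc.IH by (simp add: funpow_swap1)
  finally show ?case .
qed simp

text \<open>Pascal's rule for powers of (index shift + d) acting on the sequence \<open>f\<close>:
  the left side applies the operator once more to its k-th power.\<close>

lemma sum_binomial_Suc:
  fixes d :: "'a::comm_ring_1"
  shows "(\<Sum>j\<le>k. of_nat (k choose j) * d ^ (k - j) * (f (Suc j) + d * f j)) =
    (\<Sum>j\<le>Suc k. of_nat (Suc k choose j) * d ^ (Suc k - j) * f j)"
proof -
  have "(\<Sum>j\<le>Suc k. of_nat (Suc k choose j) * d ^ (Suc k - j) * f j) =
     d ^ Suc k * f 0 + (\<Sum>j\<le>k. of_nat (k choose Suc j) * d ^ (k - j) * f (Suc j)) +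
     (\<Sum>j\<le>k. of_nat (k choose j) * d ^ (k - j) * f (Suc j))"
    by (subst sum.atMost_Suc_shift) (simp add: algebra_simps sum.distrib)
  also have "d ^ Suc k * f 0 + (\<Sum>j\<le>k. of_nat (k choose Suc j) * d ^ (k - j) * f (Suc j)) =
     (\<Sum>j\<le>Suc k. of_nat (k choose j) * d ^ (Suc k - j) * f j)"
    by (subst sum.atMost_Suc_shift) (simp add: algebra_simps)
  also have "\<dots> = (\<Sum>j\<le>k. of_nat (k choose j) * d ^ (k - j) * (d * f j))"
    by (simp add: binomial_eq_0) (auto simp: Suc_diff_le algebra_simps intro!: sum.cong)
  finally show ?thesis by (simp add: distrib_left sum.distrib add.commute)
qed

text \<open>Translation by \<open>c\<close> changes the raising operator \<open>2x - d/dx\<close> by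
  the scalar \<open>2 * c\<close>, which commutes with it, so its k-th power expands
  binomially.\<close>

lemma pcompose_hermite_poly:
  "pcompose (hermite_poly k) [:c, 1:] =
     (\<Sum>j\<le>k. smult (of_nat (k choose j) * (2 * c) ^ (k - j)) (hermite_poly j))"
proof (induction k)
  case (Suc k)
  let ?A = "\<lambda>p. [:2 * c, 2:] * p - pderiv p"
  have A: "?A (hermite_poly j) = hermite_poly (Suc j) + smult (2 * c) (hermite_poly j)" for j
    by simp
  have "pcompose (hermite_poly (Suc k)) [:c, 1:] = ?A (pcompose (hermite_poly k) [:c, 1:])"
    by (simp add: pcompose_diff pcompose_mult pcompose_pCons pcompose_smult pderiv_pcompose pderiv_pCons smult_add_right)
  also have "\<dots> = (\<Sum>j\<le>k. smult (of_nat (k choose j) * (2 * c) ^ (k - j)) (?A (hermite_poly j)))"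
    unfolding Suc.IH by (simp add: sum_distrib_left pderiv_sum pderiv_smult sum_subtractf smult_diff_right del: mult_pCons_left)
  also have "\<dots> = (\<Sum>j\<le>Suc k. smult (of_nat (Suc k choose j) * (2 * c) ^ (Suc k - j)) (hermite_poly j))"
    unfolding A
    using sum_binomial_Suc[of k "[:2 * c:]" hermite_poly]
    by (simp add: of_nat_poly pCons_one smult_smult poly_const_pow mult_ac del: binomial_Suc_Suc hermite_poly.simps)
  finally show ?case .
qed (simp add: one_pCons pcompose_pCons)

lemma pderiv_iter_pcompose_hermite_poly:
  "j \<le> k \<Longrightarrow> (pderiv ^^ j) (pcompose (hermite_poly k) [:c, 1:]) =
     smult (2 ^ j * (fact k / fact (k - j))) (pcompose (hermite_poly (k - j)) [:c, 1:])"
proof (induction j)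
  case (Suc j)
  then obtain m where m: "k - j = Suc m" "k - Suc j = m" by (metis Suc_diff_Suc Suc_le_lessD)
  have "(pderiv ^^ Suc j) (pcompose (hermite_poly k) [:c, 1:]) =
      smult (2 ^ j * (fact k / fact (Suc m))) (smult (2 * of_nat (Suc m)) (pcompose (hermite_poly m) [:c, 1:]))"
    using Suc by (simp add: m pderiv_smult pderiv_pcompose pderiv_hermite_poly pcompose_smult pderiv_pCons del: hermite_poly.simps)
  thus ?case
    unfolding m by (simp add: field_simps del: of_nat_Suc)
qed simp

text \<open>In the binomial expansion only \<open>j = 0\<close> survives, the other H_j being
  orthogonal to 1.\<close>

lemma gauss_integral_pcompose_hermite_poly:
  "gauss_integral (pcompose (hermite_poly k) [:c, 1:]) = (2 * c) ^ k * of_real (sqrt pi)"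
proof -
  have "gauss_integral (hermite_poly j) = (if j = 0 then of_real (sqrt pi) else 0)" for j
    using gauss_integral_hermite_mult[of j 1]
    by (cases j) (simp_all add: gauss_integral_1 gauss_integral_0 funpow_swap1 del: hermite_poly.simps(2))
  hence "gauss_integral (pcompose (hermite_poly k) [:c, 1:]) =
     (\<Sum>j\<le>k. if j = 0 then (2 * c) ^ k * of_real (sqrt pi) else 0)"
    unfolding pcompose_hermite_poly gauss_integral_sum gauss_integral_smult by (intro sum.cong) simp_all
  thus ?thesis by simp
qed

text \<open>Only the first factor is expanded; each resulting H_j acts on the second as j
  derivatives, leaving a shifted H_(k-j) whose integral is known. The sum is the Laguerre value
  L_k(2c^2), so \<open>c = \<i> * a\<close> will give L_k(-2a^2).\<close>

lemma gauss_integral_hermite_shift: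
  "gauss_integral (pcompose (hermite_poly k) [:c, 1:] * pcompose (hermite_poly k) [:- c, 1:]) =
     of_real (sqrt pi) * 2 ^ k * fact k * (\<Sum>j\<le>k. of_nat (k choose j) / fact j * (- (2 * c\<^sup>2)) ^ j)"
proof -
  have summand: "of_nat (k choose j) * (2 * c) ^ (k - j) *
       gauss_integral (hermite_poly j * pcompose (hermite_poly k) [:- c, 1:]) =
     of_real (sqrt pi) * 2 ^ k * fact k * (of_nat (k choose (k - j)) / fact (k - j) * (- (2 * c\<^sup>2)) ^ (k - j))"
    if "j \<le> k" for j
  proof -
    have "(2 * c) * (2 * (- c)) = 2 * (- (2 * c\<^sup>2))"
      by (simp add: power2_eq_square)
    hence "(2 * c) ^ (k - j) * (2 * (- c)) ^ (k - j) = (2 * (- (2 * c\<^sup>2))) ^ (k - j)"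
      by (metis power_mult_distrib)
    also have "\<dots> = 2 ^ (k - j) * (- (2 * c\<^sup>2)) ^ (k - j)" by (rule power_mult_distrib)
    finally have 1: "(2 * c) ^ (k - j) * (2 * (- c)) ^ (k - j) = 2 ^ (k - j) * (- (2 * c\<^sup>2)) ^ (k - j)" .
    have 2: "(2::complex) ^ j * 2 ^ (k - j) = 2 ^ k" using that by (simp flip: power_add)
    have "of_nat (k choose j) * (2 * c) ^ (k - j) *
       gauss_integral (hermite_poly j * pcompose (hermite_poly k) [:- c, 1:]) =
       of_real (sqrt pi) * (2 ^ j * ((2 * c) ^ (k - j) * (2 * (- c)) ^ (k - j))) * fact k * (of_nat (k choose j) / fact (k - j))"
      using that by (simp add: gauss_integral_hermite_mult pderiv_iter_pcompose_hermite_poly gauss_integral_smult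
          gauss_integral_pcompose_hermite_poly)
    also have "\<dots> = of_real (sqrt pi) * (2 ^ j * 2 ^ (k - j)) * fact k * (of_nat (k choose j) / fact (k - j) * (- (2 * c\<^sup>2)) ^ (k - j))"
      unfolding 1 by simp
    also have "\<dots> = of_real (sqrt pi) * 2 ^ k * fact k * (of_nat (k choose (k - j)) / fact (k - j) * (- (2 * c\<^sup>2)) ^ (k - j))"
      unfolding 2 binomial_symmetric[OF that] by (rule refl)
    finally show ?thesis .
  qed
  have "gauss_integral (pcompose (hermite_poly k) [:c, 1:] * pcompose (hermite_poly k) [:- c, 1:]) =
     (\<Sum>j\<le>k. of_nat (k choose j) * (2 * c) ^ (k - j) *
       gauss_integral (hermite_poly j * pcompose (hermite_poly k) [:- c, 1:]))"
    unfolding pcompose_hermite_poly[of k c] sum_distrib_right gauss_integral_sum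
    by (simp add: gauss_integral_smult)
  also have "\<dots> = (\<Sum>j\<le>k. of_real (sqrt pi) * 2 ^ k * fact k * (of_nat (k choose (k - j)) / fact (k - j) * (- (2 * c\<^sup>2)) ^ (k - j)))"
    by (intro sum.cong refl summand) simp
  also have "\<dots> = (\<Sum>j\<le>k. of_real (sqrt pi) * 2 ^ k * fact k * (of_nat (k choose j) / fact j * (- (2 * c\<^sup>2)) ^ j))"
    by (rule sum.reindex_bij_witness[of _ "\<lambda>j. k - j" "\<lambda>j. k - j"]) auto
  finally show ?thesis by (simp add: sum_distrib_left)
qed

section \<open>Rank-one operators on L^2 and the norms of shifted Hermite functions\<close>

lemma L2_integrable_prod:
  assumes "f \<in> L2" "g \<in> L2"
  shows "integrable lborel (\<lambda>y. cmod (f y) * cmod (g y))"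
proof (rule Bochner_Integration.integrable_bound)
  show "integrable lborel (\<lambda>y. (cmod (f y))\<^sup>2 + (cmod (g y))\<^sup>2)"
    using assms by (auto simp: L2_def)
  show "(\<lambda>y. cmod (f y) * cmod (g y)) \<in> borel_measurable lborel"
    using assms by (auto simp: L2_def)
  have "a * b \<le> a\<^sup>2 + b\<^sup>2" if "a \<ge> 0" "b \<ge> 0" for a b :: real
    using that sum_squares_bound[of a b] mult_nonneg_nonneg[OF that] by linarith
  thus "AE y in lborel. norm (cmod (f y) * cmod (g y)) \<le> norm ((cmod (f y))\<^sup>2 + (cmod (g y))\<^sup>2)"
    by (intro always_eventually allI) simp
qed

lemma l2_norm_nonneg: "l2_norm f \<ge> 0"
  unfolding l2_norm_def by (intro real_sqrt_ge_zero Bochner_Integration.integral_nonneg) simp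

text \<open>Integrate the square of \<open>b * cmod (f y) - a * cmod (g y)\<close>, with a and b the
  two norms, and cancel the positive product \<open>a * b\<close>.\<close>

lemma l2_cauchy_schwarz:
  assumes "f \<in> L2" "g \<in> L2" "l2_norm f > 0" "l2_norm g > 0"
  shows "cmod (l2_inner f g) \<le> l2_norm f * l2_norm g"
proof -
  define a b where "a = l2_norm f" and "b = l2_norm g"
  define J where "J = (LINT y|lborel. cmod (f y) * cmod (g y))"
  have int: "integrable lborel (\<lambda>y. (cmod (f y))\<^sup>2)" "integrable lborel (\<lambda>y. (cmod (g y))\<^sup>2)"
    using assms by (auto simp: L2_def)
  have sq: "a\<^sup>2 = (LINT y|lborel. (cmod (f y))\<^sup>2)" "b\<^sup>2 = (LINT y|lborel. (cmod (g y))\<^sup>2)"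
    by (simp_all add: a_def b_def l2_norm_def Bochner_Integration.integral_nonneg)
  have "0 \<le> (LINT y|lborel. (b * cmod (f y) - a * cmod (g y))\<^sup>2)"
    by (intro Bochner_Integration.integral_nonneg) simp
  also have "(\<lambda>y. (b * cmod (f y) - a * cmod (g y))\<^sup>2) =
      (\<lambda>y. b\<^sup>2 * (cmod (f y))\<^sup>2 + a\<^sup>2 * (cmod (g y))\<^sup>2 - 2 * a * b * (cmod (f y) * cmod (g y)))"
    by (simp add: fun_eq_iff power2_eq_square algebra_simps)
  also have "(LINT y|lborel. b\<^sup>2 * (cmod (f y))\<^sup>2 + a\<^sup>2 * (cmod (g y))\<^sup>2 - 2 * a * b * (cmod (f y) * cmod (g y)))
      = b\<^sup>2 * a\<^sup>2 + a\<^sup>2 * b\<^sup>2 - 2 * a * b * J"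
    using int L2_integrable_prod[OF assms(1,2)] by (simp add: sq J_def)
  finally have "(a * b) * J \<le> (a * b) * (a * b)"
    by (simp add: power2_eq_square algebra_simps)
  moreover have "a * b > 0" using assms by (simp add: a_def b_def)
  ultimately have "J \<le> a * b" by (simp only: mult_le_cancel_left_pos)
  moreover have "cmod (l2_inner f g) \<le> J"
    unfolding l2_inner_def J_def
    using integral_norm_bound[of lborel "\<lambda>y. f y * cnj (g y)"] by (simp add: norm_mult)
  ultimately show ?thesis by (simp add: a_def b_def)
qed

text \<open>Cauchy-Schwarz bounds every quotient and \<open>f = g\<close> attains the bound. An
  \<open>f\<close> of norm zero contributes 0, by the value of division by zero.\<close>

lemma l2_onorm_rank_one:
  assumes "g \<in> L2" "l2_norm g > 0"
  shows "l2_onorm (\<lambda>f y. l2_inner f g * h y) = l2_norm g * l2_norm h"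
proof -
  have norm: "l2_norm (\<lambda>y. c * h y) = cmod c * l2_norm h" for c
    by (simp add: l2_norm_def norm_mult power_mult_distrib real_sqrt_mult)
  have "l2_inner g g = of_real ((l2_norm g)\<^sup>2)"
    by (simp add: l2_inner_def l2_norm_def complex_norm_square[symmetric] Bochner_Integration.integral_nonneg
        del: of_real_power)
  hence "cmod (l2_inner g g) * l2_norm h / l2_norm g = l2_norm g * l2_norm h"
    using assms(2) by (simp add: power2_eq_square norm_mult)
  hence attained: "l2_norm g * l2_norm h \<in> (\<lambda>f. l2_norm (\<lambda>y. l2_inner f g * h y) / l2_norm f) ` L2"
    unfolding norm using assms(1) by (metis (mono_tags, lifting) image_eqI)
  moreover have "cmod (l2_inner f g) * l2_norm h / l2_norm f \<le> l2_norm g * l2_norm h" if "f \<in> L2" for f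
  proof (cases "l2_norm f = 0")
    case False
    hence pos: "l2_norm f > 0" using l2_norm_nonneg[of f] by simp
    have "cmod (l2_inner f g) * l2_norm h \<le> l2_norm f * l2_norm g * l2_norm h"
      by (intro mult_right_mono l2_cauchy_schwarz that assms pos l2_norm_nonneg)
    thus ?thesis using pos by (simp add: field_simps)
  qed (simp add: l2_norm_nonneg)
  ultimately show ?thesis
    unfolding l2_onorm_def norm by (intro cSup_eq_maximum) auto
qed

text \<open>For z = y + ia the Gaussian contributes exp(a^2 - y^2), and conjugation symmetry writes
  |H_k(z)|^2 through the shifts by ia and -ia. The right side has the form of the integrand of
  \<open>gauss_integral\<close>.\<close>

lemma cmod_hermite_fun_sq:
  fixes y a :: real
  shows "complex_of_real ((cmod (hermite_fun k (of_real y + \<i> * of_real a)))\<^sup>2) =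
    of_real (exp (a\<^sup>2) / (2 ^ k * fact k * sqrt pi)) *
    (poly (pcompose (hermite_poly k) [:\<i> * of_real a, 1:] * pcompose (hermite_poly k) [:- (\<i> * of_real a), 1:]) (of_real y)
      * of_real (exp (- y\<^sup>2)))"
proof -
  define z where "z = of_real y + \<i> * complex_of_real a"
  define N where "N = 2 ^ k * fact k * sqrt pi"
  define P where "P = poly (hermite_poly k) z"
  have "N > 0" by (simp add: N_def)
  have "(N powr (- (1 / 2)))\<^sup>2 = N powr (- (1 / 2) + - (1 / 2))"
    unfolding power2_eq_square by (rule powr_add[symmetric])
  hence N2: "(N powr (- (1 / 2)))\<^sup>2 = 1 / N"
    using \<open>N > 0\<close> by (simp add: powr_minus_divide)
  have e: "(cmod (exp (- (z\<^sup>2 / 2))))\<^sup>2 = exp (a\<^sup>2) * exp (- y\<^sup>2)"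
    by (simp add: z_def power2_eq_square algebra_simps flip: exp_add)
  have "cnj z = of_real y - \<i> * of_real a" by (simp add: z_def)
  hence P: "of_real ((cmod P)\<^sup>2) =
      poly (pcompose (hermite_poly k) [:\<i> * of_real a, 1:] * pcompose (hermite_poly k) [:- (\<i> * of_real a), 1:]) (of_real y)"
    unfolding complex_norm_square P_def cnj_poly_hermite_poly
    by (simp add: poly_pcompose z_def algebra_simps)
  have "(cmod (hermite_fun k z))\<^sup>2 = (N powr (- (1 / 2)))\<^sup>2 * ((cmod P)\<^sup>2 * (cmod (exp (- (z\<^sup>2 / 2))))\<^sup>2)"
    by (simp only: hermite_fun_eq N_def P_def norm_mult power_mult_distrib norm_of_real power2_abs)
  also have "\<dots> = exp (a\<^sup>2) / N * ((cmod P)\<^sup>2 * exp (- y\<^sup>2))"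
    unfolding N2 e by simp
  finally show ?thesis
    unfolding z_def[symmetric] N_def[symmetric] P[symmetric] by (simp only: of_real_mult)
qed

lemma hermite_fun_shift_L2:
  fixes a :: real
  shows "(\<lambda>y. hermite_fun k (of_real y + \<i> * of_real a)) \<in> L2"
    and "(l2_norm (\<lambda>y. hermite_fun k (of_real y + \<i> * of_real a)))\<^sup>2 =
      exp (a\<^sup>2) * (\<Sum>j\<le>k. real (k choose j) / fact j * (2 * a\<^sup>2) ^ j)"
proof -
  let ?g = "\<lambda>y::real. hermite_fun k (of_real y + \<i> * of_real a)"
  let ?C = "exp (a\<^sup>2) / (2 ^ k * fact k * sqrt pi)"
  let ?p = "pcompose (hermite_poly k) [:\<i> * of_real a, 1:] * pcompose (hermite_poly k) [:- (\<i> * of_real a), 1:]"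
  have "integrable lborel (\<lambda>y. complex_of_real ((cmod (?g y))\<^sup>2))"
    unfolding cmod_hermite_fun_sq by (intro integrable_mult_right integrable_gauss_poly)
  hence "integrable lborel (\<lambda>y. (cmod (?g y))\<^sup>2)"
    by (simp only: complex_of_real_integrable_eq)
  moreover have "?g \<in> borel_measurable lborel"
  proof -
    have "continuous_on UNIV ?g"
      unfolding hermite_fun_eq
      by (rule continuous_on_mult[OF continuous_on_const]) (auto intro!: continuous_intros)
    thus ?thesis using borel_measurable_continuous_onI by simp
  qed
  ultimately show "?g \<in> L2" by (simp add: L2_def)
  have "complex_of_real ((l2_norm ?g)\<^sup>2) = (LINT y|lborel. complex_of_real ((cmod (?g y))\<^sup>2))"
    by (simp add: l2_norm_def Bochner_Integration.integral_nonneg del: of_real_power)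
  also have "\<dots> = of_real ?C * gauss_integral ?p"
    unfolding cmod_hermite_fun_sq gauss_integral_def by (rule integral_mult_right_zero)
  also have "\<dots> = of_real (?C * (sqrt pi * 2 ^ k * fact k * (\<Sum>j\<le>k. real (k choose j) / fact j * (2 * a\<^sup>2) ^ j)))"
    unfolding gauss_integral_hermite_shift by (simp add: power_mult_distrib)
  also have "?C * (sqrt pi * 2 ^ k * fact k * (\<Sum>j\<le>k. real (k choose j) / fact j * (2 * a\<^sup>2) ^ j)) =
      exp (a\<^sup>2) * (\<Sum>j\<le>k. real (k choose j) / fact j * (2 * a\<^sup>2) ^ j)"
    by simp
  finally show "(l2_norm ?g)\<^sup>2 = exp (a\<^sup>2) * (\<Sum>j\<le>k. real (k choose j) / fact j * (2 * a\<^sup>2) ^ j)"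
    by (simp only: of_real_eq_iff)
qed

text \<open>The projection pairs with the shift by \<open>a\<close> and maps onto the shift by
  \<open>- a\<close>. Their norms agree because the formula depends on \<open>a\<close> only through
  its square.\<close>

lemma l2_onorm_spectral_proj:
  "l2_onorm (spectral_proj a k) = exp (a\<^sup>2) * (\<Sum>j\<le>k. real (k choose j) / fact j * (2 * a\<^sup>2) ^ j)"
proof -
  let ?g = "\<lambda>b y. hermite_fun k (of_real y + \<i> * of_real b)"
  let ?n = "\<lambda>b. l2_norm (\<lambda>y. hermite_fun k (of_real y + \<i> * of_real b))"
  let ?N = "exp (a\<^sup>2) * (\<Sum>j\<le>k. real (k choose j) / fact j * (2 * a\<^sup>2) ^ j)"
  have sq: "(?n a)\<^sup>2 = ?N" "(?n (- a))\<^sup>2 = ?N"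
    by (simp_all only: hermite_fun_shift_L2 power2_minus)
  have "(\<Sum>j\<in>{0}. real (k choose j) / fact j * (2 * a\<^sup>2) ^ j) \<le> (\<Sum>j\<le>k. real (k choose j) / fact j * (2 * a\<^sup>2) ^ j)"
    by (intro sum_mono2) auto
  hence "?N > 0" by (intro mult_pos_pos) auto
  hence pos: "?n a > 0" using sq(1) l2_norm_nonneg[of "?g a"] by (cases "?n a = 0") auto
  have eq: "?n (- a) = ?n a"
    by (rule power2_eq_imp_eq) (simp_all only: sq l2_norm_nonneg)
  have "spectral_proj a k = (\<lambda>f y. l2_inner f (?g a) * ?g (- a) y)"
    by (simp add: spectral_proj_def fun_eq_iff)
  hence "l2_onorm (spectral_proj a k) = ?n a * ?n (- a)"
    using l2_onorm_rank_one[OF hermite_fun_shift_L2(1) pos] by simp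
  also have "\<dots> = ?N" unfolding eq sq(1)[symmetric] by (simp add: power2_eq_square)
  finally show ?thesis .
qed

section \<open>Stirling's formula\<close>

text \<open>Logarithm of the ratio of sqrt(2 pi) (k_1/e)^(k_1) to k!, where k_1 = k + 1/2. Centering
  Stirling's formula at the half-integer absorbs the usual factor sqrt(k).\<close>

definition stirling_defect :: "nat \<Rightarrow> real" where
  "stirling_defect k = (real k + 1 / 2) * ln (real k + 1 / 2) - (real k + 1 / 2)
     - ln (fact k) + ln (2 * pi) / 2"

text \<open>The derivative of \<open>F - 2 * h\<close> in \<open>h\<close> is ln(1 - h^2), so the
  mean value theorem reduces both bounds to that logarithm.\<close>

lemma entropy_difference_bounds:
  assumes "0 < h" "h \<le> 1 / (2::real)"
  defines "F \<equiv> (1 + h) * ln (1 + h) - (1 - h) * ln (1 - h)"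
  shows "F \<le> 2 * h" "2 * h - 2 * h ^ 3 \<le> F"
proof -
  let ?f = "\<lambda>z::real. (1 + z) * ln (1 + z) - (1 - z) * ln (1 - z) - 2 * z"
  have "\<exists>z>0. z < h \<and> ?f h - ?f 0 = (h - 0) * (ln (1 + z) + ln (1 - z))"
    using assms(1,2) by (intro MVT2) (auto intro!: derivative_eq_intros)
  then obtain z where z: "0 < z" "z < h" "F - 2 * h = h * (ln (1 + z) + ln (1 - z))"
    by (auto simp: F_def)
  have z2: "0 < z\<^sup>2" "z\<^sup>2 \<le> h\<^sup>2" "z\<^sup>2 \<le> 1 / 4"
    using z assms(1,2) power_mono[of z h 2] power_mono[of z "1/2" 2] by (auto simp: power_divide)
  have "ln (1 + z) + ln (1 - z) = ln ((1 + z) * (1 - z))"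
    using z assms(1,2) by (intro ln_mult_pos[symmetric]) auto
  also have "(1 + z) * (1 - z) = 1 - z\<^sup>2"
    by (simp add: power2_eq_square algebra_simps)
  finally have "ln (1 + z) + ln (1 - z) = ln (1 - z\<^sup>2)" .
  moreover have "ln (1 - z\<^sup>2) \<le> 0"
    using z2 by simp
  moreover have "- (2 * h\<^sup>2) \<le> ln (1 - z\<^sup>2)"
    using ln_one_minus_pos_lower_bound[of "z\<^sup>2"] z2 mult_mono[of "z\<^sup>2" "1/4" "z\<^sup>2" "z\<^sup>2"]
    by (simp add: power2_eq_square)
  ultimately have "h * (ln (1 + z) + ln (1 - z)) \<le> 0" "h * - (2 * h\<^sup>2) \<le> h * (ln (1 + z) + ln (1 - z))"
    using assms(1) by (simp add: mult_le_0_iff, intro mult_left_mono) simp_all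
  thus "F \<le> 2 * h" "2 * h - 2 * h ^ 3 \<le> F"
    using z(3) by (auto simp: power3_eq_cube power2_eq_square)
qed

text \<open>With \<open>m\<close> the midpoint of the two half-integers and
  \<open>h = 1 / (2 * m)\<close>, the increment is exactly \<open>m * (F - 2 * h)\<close>. It lies
  between -1/(4m^2) and 0, and 1/(4m^2) is dominated by a telescoping difference.\<close>

lemma stirling_defect_Suc_bounds:
  "stirling_defect (Suc k) \<le> stirling_defect k"
  "stirling_defect k - 1 / (4 * (real k + 1 / 2)) \<le>
     stirling_defect (Suc k) - 1 / (4 * (real (Suc k) + 1 / 2))"
proof -
  define m where "m = real k + 1"
  define h where "h = 1 / (2 * m)"
  define F where "F = (1 + h) * ln (1 + h) - (1 - h) * ln (1 - h)"
  have m: "m \<ge> 1" by (simp add: m_def)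
  have h: "0 < h" "h \<le> 1 / 2" "m * h = 1 / 2" using m by (auto simp: h_def field_simps)
  have pm: "m + 1 / 2 = m * (1 + h)" "m - 1 / 2 = m * (1 - h)" using h by (auto simp: algebra_simps)
  have "fact (Suc k) = m * fact k" by (simp add: m_def)
  hence ln_fact: "ln (fact (Suc k)) = ln m + ln (fact k)" using m by (simp add: ln_mult del: fact_Suc)
  have km: "real (Suc k) + 1 / 2 = m + 1 / 2" "real k + 1 / 2 = m - 1 / 2"
    by (auto simp: m_def)
  have "stirling_defect (Suc k) - stirling_defect k =
     (m + 1 / 2) * ln (m + 1 / 2) - (m - 1 / 2) * ln (m - 1 / 2) - 1 - ln m"
    unfolding stirling_defect_def ln_fact km by simp
  also have "ln (m + 1 / 2) = ln m + ln (1 + h)" unfolding pm using m h by (intro ln_mult_pos) auto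
  also have "ln (m - 1 / 2) = ln m + ln (1 - h)" unfolding pm using m h by (intro ln_mult_pos) auto
  also have "(m + 1 / 2) * (ln m + ln (1 + h)) - (m - 1 / 2) * (ln m + ln (1 - h)) - 1 - ln m
     = (m + 1 / 2) * ln (1 + h) - (m - 1 / 2) * ln (1 - h) - 1"
    by (simp add: algebra_simps)
  also have "\<dots> = m * F - 1"
    unfolding pm F_def by (simp add: algebra_simps)
  also have "\<dots> = m * (F - 2 * h)" using h(3) by (simp add: algebra_simps)
  finally have eq: "stirling_defect (Suc k) - stirling_defect k = m * (F - 2 * h)" .
  have "m * (F - 2 * h) \<le> 0"
    using entropy_difference_bounds(1)[OF h(1,2)] m by (simp add: F_def mult_le_0_iff)
  thus "stirling_defect (Suc k) \<le> stirling_defect k" using eq by simp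
  have "m * (- (2 * h ^ 3)) \<le> m * (F - 2 * h)"
    using entropy_difference_bounds(2)[OF h(1,2)] m by (intro mult_left_mono) (auto simp: F_def)
  moreover have "m * (- (2 * h ^ 3)) = - (1 / (4 * m\<^sup>2))"
    using m by (simp add: h_def field_simps power2_eq_square power3_eq_cube)
  moreover have "1 / (4 * m\<^sup>2) \<le> 1 / (4 * (m - 1 / 2)) - 1 / (4 * (m + 1 / 2))"
  proof -
    have "1 / (4 * (m - 1 / 2)) - 1 / (4 * (m + 1 / 2)) = 1 / (4 * m\<^sup>2 - 1)"
    proof -
      have "4 * m\<^sup>2 - 1 = (2 * m - 1) * (2 * m + 1)" by (simp add: power2_eq_square algebra_simps)
      thus ?thesis using m by (simp add: divide_simps) (simp add: algebra_simps)
    qed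
    moreover have "1 / (4 * m\<^sup>2) \<le> 1 / (4 * m\<^sup>2 - 1)"
      using one_le_power[OF m, of 2] by (intro divide_left_mono mult_pos_pos) auto
    ultimately show ?thesis by simp
  qed
  ultimately show "stirling_defect k - 1 / (4 * (real k + 1 / 2)) \<le>
     stirling_defect (Suc k) - 1 / (4 * (real (Suc k) + 1 / 2))"
    unfolding km using eq by linarith
qed

text \<open>Factorial form of Wallis' product, through which pi enters Stirling's formula.\<close>

lemma wallis_product_eq:
  "(\<Prod>k=1..n. (4 * real k ^ 2) / (4 * real k ^ 2 - 1)) =
     2 ^ (4 * n) * fact n ^ 4 / ((fact (2 * n))\<^sup>2 * (2 * real n + 1))"
proof (induction n)
  case (Suc n)
  define s p q where "s = real n + 1" and "p = 2 * real n + 1" and "q = 2 * real n + 3"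
  have pos: "s > 0" "p > 0" "q > 0" by (auto simp: s_def p_def q_def)
  have step: "a * f ^ 4 / (g\<^sup>2 * p) * (4 * s\<^sup>2 / (p * q)) = 16 * a * (s * f) ^ 4 / ((2 * s * p * g)\<^sup>2 * q)"
    if "g > 0" for a f g :: real
    using pos that by (simp add: field_simps power2_eq_square power4_eq_xxxx)
  have "4 * real (Suc n) ^ 2 - 1 = p * q" "4 * real (Suc n) ^ 2 = 4 * s\<^sup>2"
    by (simp_all add: s_def p_def q_def power2_eq_square algebra_simps)
  hence "(\<Prod>k=1..Suc n. (4 * real k ^ 2) / (4 * real k ^ 2 - 1)) =
      2 ^ (4 * n) * fact n ^ 4 / ((fact (2 * n))\<^sup>2 * p) * (4 * s\<^sup>2 / (p * q))"
    using Suc.IH by (simp add: p_def)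
  also have "\<dots> = 16 * 2 ^ (4 * n) * (s * fact n) ^ 4 / ((2 * s * p * fact (2 * n))\<^sup>2 * q)"
    by (rule step) simp
  also have "16 * 2 ^ (4 * n) = (2::real) ^ (4 * Suc n)" by (simp add: power_add)
  also have "s * fact n = fact (Suc n)" by (simp add: s_def)
  also have "2 * s * p * fact (2 * n) = fact (2 * Suc n)" by (simp add: s_def p_def algebra_simps)
  also have "q = 2 * real (Suc n) + 1" by (simp add: q_def)
  finally show ?case .
qed simp

text \<open>Monotonicity and a lower bound give a limit L. The combination
  \<open>2 * stirling_defect (2 * n) - 4 * stirling_defect n\<close> contains the factorials of
  Wallis' product: it tends to -2L, and by Wallis to 0.\<close>

lemma stirling_defect_tendsto: "stirling_defect \<longlonglongrightarrow> 0"
proof -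
  have dec: "decseq stirling_defect"
    by (rule decseq_SucI) (rule stirling_defect_Suc_bounds)
  have "incseq (\<lambda>k. stirling_defect k - 1 / (4 * (real k + 1 / 2)))"
    by (rule incseq_SucI) (rule stirling_defect_Suc_bounds)
  hence "stirling_defect 0 - 1 / 2 \<le> stirling_defect k - 1 / (4 * (real k + 1 / 2))" for k
    using incseqD[of _ 0 k] by fastforce
  moreover have "0 \<le> 1 / (4 * (real k + 1 / 2))" for k by simp
  ultimately have "stirling_defect 0 - 1 / 2 \<le> stirling_defect k" for k
    by (smt (verit))
  with decseq_convergent[OF dec] obtain L where L: "stirling_defect \<longlonglongrightarrow> L" by blast
  have L2: "(\<lambda>n. stirling_defect (2 * n)) \<longlonglongrightarrow> L"
    by (rule filterlim_compose[OF L]) real_asymp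
  define P where "P n = (\<Prod>k=1..n. (4 * real k ^ 2) / (4 * real k ^ 2 - 1))" for n
  \<comment> \<open>\<open>B\<close> collects the elementary terms, chosen so that
    \<open>ln (P n) - ln (2 * pi) - B (real n)\<close> is exactly that combination of
    defects.\<close>
  define B where "B x = 4 * x * ln 2 + 4 * ((x + 1/2) * ln (x + 1/2) - (x + 1/2))
     - 2 * ((2 * x + 1/2) * ln (2 * x + 1/2) - (2 * x + 1/2)) - ln (2 * x + 1)" for x :: real
  have lim_P: "(\<lambda>n. ln (P n)) \<longlonglongrightarrow> ln (pi / 2)"
    unfolding P_def by (intro tendsto_ln wallis) simp
  have lim_B: "(\<lambda>n. B (real n)) \<longlonglongrightarrow> - (2 * ln 2)"
    unfolding B_def by real_asymp
  have "(\<lambda>n. ln (P n) - ln (2 * pi) - B (real n)) \<longlonglongrightarrow> ln (pi / 2) - ln (2 * pi) - - (2 * ln 2)"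
    by (intro tendsto_diff tendsto_const lim_P lim_B)
  also have "(\<lambda>n. ln (P n) - ln (2 * pi) - B (real n)) = (\<lambda>n. 2 * stirling_defect (2 * n) - 4 * stirling_defect n)"
  proof
    fix n
    have "ln (P n) = 4 * real n * ln 2 + 4 * ln (fact n) - 2 * ln (fact (2 * n)) - ln (2 * real n + 1)"
      unfolding P_def wallis_product_eq
      by (subst ln_div; simp add: ln_mult ln_realpow)
    thus "ln (P n) - ln (2 * pi) - B (real n) = 2 * stirling_defect (2 * n) - 4 * stirling_defect n"
      by (simp add: B_def stirling_defect_def algebra_simps)
  qed
  finally have lim: "(\<lambda>n. 2 * stirling_defect (2 * n) - 4 * stirling_defect n) \<longlonglongrightarrow>
    ln (pi / 2) - ln (2 * pi) - - (2 * ln 2)" .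
  have "(\<lambda>n. 2 * stirling_defect (2 * n) - 4 * stirling_defect n) \<longlonglongrightarrow> 2 * L - 4 * L"
    by (intro tendsto_intros L L2)
  from LIMSEQ_unique[OF this lim]
  have "2 * L - 4 * L = ln (pi / 2) - ln (2 * pi) - - (2 * ln 2)" .
  hence "L = 0" by (simp add: ln_div ln_mult)
  thus ?thesis using L by simp
qed

text \<open>Two monotone sequences with limit 0: the decreasing defect stays above it, the
  increasing corrected defect below.\<close>

lemma stirling_defect_bound: "\<bar>stirling_defect k\<bar> \<le> 1 / (4 * (real k + 1 / 2))"
proof -
  have "decseq stirling_defect"
    by (rule decseq_SucI) (rule stirling_defect_Suc_bounds)
  hence "0 \<le> stirling_defect k"
    by (rule decseq_ge) (rule stirling_defect_tendsto)
  moreover have "(\<lambda>k. stirling_defect k - 1 / (4 * (real k + 1 / 2))) \<longlonglongrightarrow> 0 - 0"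
    by (intro tendsto_diff stirling_defect_tendsto) real_asymp
  moreover have "incseq (\<lambda>k. stirling_defect k - 1 / (4 * (real k + 1 / 2)))"
    by (rule incseq_SucI) (rule stirling_defect_Suc_bounds)
  ultimately have "stirling_defect k - 1 / (4 * (real k + 1 / 2)) \<le> 0"
    using incseq_le[of "\<lambda>k. stirling_defect k - 1 / (4 * (real k + 1 / 2))" 0 k] by simp
  with \<open>0 \<le> stirling_defect k\<close> show ?thesis by simp
qed

section \<open>Laguerre polynomials at negative arguments\<close>

text \<open>If \<open>f u < 0\<close>, let s be the last point of [0, u] where f is nonnegative.
  Beyond s the function is negative, hence nondecreasing by \<open>restore\<close>, and the mean
  value theorem gives a contradiction. Differentiability is asked only for \<open>t > 0\<close>,
  since the equations below have a factor coth t.\<close>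

lemma nonneg_by_barrier:
  fixes f f' :: "real \<Rightarrow> real"
  assumes cont: "continuous_on {0..} f" and f0: "f 0 \<ge> 0"
    and deriv: "\<And>t. t > 0 \<Longrightarrow> (f has_real_derivative f' t) (at t)"
    and restore: "\<And>t. t > 0 \<Longrightarrow> f t < 0 \<Longrightarrow> f' t \<ge> 0"
    and "u \<ge> 0"
  shows "f u \<ge> 0"
proof (rule ccontr)
  assume neg: "\<not> f u \<ge> 0"
  define A where "A = {0..u} \<inter> f -` {0..}"
  have cont_u: "continuous_on {0..u} f"
    using cont by (rule continuous_on_subset) auto
  have "closed A" unfolding A_def
    by (intro continuous_closed_preimage cont_u) auto
  moreover have "bounded A"
    unfolding A_def by (rule bounded_subset[of "{0..u}"]) auto
  moreover have "0 \<in> A"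
    using f0 \<open>u \<ge> 0\<close> by (auto simp: A_def)
  ultimately obtain s where s: "s \<in> A" "\<And>t. t \<in> A \<Longrightarrow> t \<le> s"
    using compact_attains_sup[of A] compact_eq_bounded_closed by blast
  have su: "0 \<le> s" "s < u" "f s \<ge> 0"
    using s(1) neg by (auto simp: A_def less_le)
  obtain l z where z: "s < z" "z < u" "(f has_real_derivative l) (at z)" "f u - f s = (u - s) * l"
  proof (rule MVT[of s u f, THEN exE])
    show "continuous_on {s..u} f"
      by (rule continuous_on_subset[OF cont_u]) (use su in auto)
    show "f differentiable (at t)" if "s < t" "t < u" for t
      using deriv[of t] that su by (auto simp: real_differentiable_def)
  qed (use su in auto)
  have "f z < 0"
    using s(2)[of z] z su by (force simp: A_def)
  moreover have "l = f' z"
    using z su by (intro DERIV_unique[OF z(3) deriv]) auto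
  ultimately have "(u - s) * l \<ge> 0"
    using restore[of z] z su by auto
  thus False using z(4) su neg by auto
qed

section \<open>Laguerre's differential equation\<close>

text \<open>The Laguerre polynomial \<open>L\<^sub>k\<close> at \<open>-x\<close>.\<close>

definition laguerre_neg :: "nat \<Rightarrow> real poly" where
  "laguerre_neg k = (\<Sum>j\<le>k. monom (real (k choose j) / fact j) j)"

lemma coeff_laguerre_neg: "coeff (laguerre_neg k) j = real (k choose j) / fact j"
  by (auto simp: laguerre_neg_def coeff_sum binomial_eq_0)

lemma poly_laguerre_neg: "poly (laguerre_neg k) x = (\<Sum>j\<le>k. real (k choose j) / fact j * x ^ j)"
  by (simp add: laguerre_neg_def poly_sum poly_monom)

text \<open>Comparing coefficients, the equation is the two-term recursion \<open>rec\<close>, which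
  is the absorption identity for binomial coefficients.\<close>

lemma laguerre_neg_ode:
  "x * poly (pderiv (pderiv (laguerre_neg k))) x + (1 + x) * poly (pderiv (laguerre_neg k)) x =
   real k * poly (laguerre_neg k) x"
proof -
  let ?q = "laguerre_neg k"
  have rec: "(real j + 1) ^ 2 * coeff ?q (Suc j) = (real k - real j) * coeff ?q j" for j
  proof -
    have "(real j + 1) * real (k choose Suc j) = (real k - real j) * real (k choose j)"
    proof (cases "j \<le> k")
      case True
      have "Suc j * (k choose Suc j) = (k - j) * (k choose j)"
        by (metis Suc_diff_le binomial_absorb_comp binomial_absorption diff_Suc_1 mult.commute binomial_symmetric) 
      hence "real (Suc j * (k choose Suc j)) = real ((k - j) * (k choose j))" by presburger
      with True show ?thesis by (simp add: of_nat_diff algebra_simps)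
    qed (simp add: binomial_eq_0)
    moreover have "real (Suc j) ^ 2 * (real (k choose Suc j) / fact (Suc j)) =
        real (Suc j) * real (k choose Suc j) / fact j"
      by (simp only: fact_Suc of_nat_mult) (simp add: power2_eq_square del: of_nat_Suc)
    ultimately show ?thesis
      by (simp add: coeff_laguerre_neg add.commute)
  qed
  have "pCons 0 (pderiv (pderiv ?q)) + pderiv ?q + pCons 0 (pderiv ?q) = smult (real k) ?q"
  proof (rule poly_eqI)
    fix j
    show "coeff (pCons 0 (pderiv (pderiv ?q)) + pderiv ?q + pCons 0 (pderiv ?q)) j = coeff (smult (real k) ?q) j"
      using rec[of j]
      by (cases j) (simp_all add: coeff_pderiv algebra_simps power2_eq_square)
  qed
  hence "poly (pCons 0 (pderiv (pderiv ?q)) + pderiv ?q + pCons 0 (pderiv ?q)) x = poly (smult (real k) ?q) x"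
    by simp
  thus ?thesis by (simp add: algebra_simps)
qed

lemma laguerre_neg_pos: "x \<ge> 0 \<Longrightarrow> poly (laguerre_neg k) x > 0"
proof -
  assume "x \<ge> 0"
  have "(\<Sum>j\<in>{0}. real (k choose j) / fact j * x ^ j) \<le> (\<Sum>j\<le>k. real (k choose j) / fact j * x ^ j)"
    using \<open>x \<ge> 0\<close> by (intro sum_mono2) auto
  thus ?thesis by (simp add: poly_laguerre_neg)
qed

lemma poly_nonneg_coeffs:
  fixes p :: "real poly"
  assumes "\<And>j. coeff p j \<ge> 0" "x \<ge> 0"
  shows "poly p x \<ge> 0"
  using assms by (auto simp: poly_altdef intro!: sum_nonneg)

lemma pderiv_laguerre_neg_nonneg: "x \<ge> 0 \<Longrightarrow> poly (pderiv (laguerre_neg k)) x \<ge> 0"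
  by (rule poly_nonneg_coeffs) (auto simp: coeff_pderiv coeff_laguerre_neg)

section \<open>The Riccati equation and its WKB approximation\<close>

text \<open>
  \<open>x F'(x) / F(x)\<close> for \<open>F(x) = exp (x / 2) L\<^sub>k(-x)\<close>. Laguerre's equation turns into
  \<open>(x d/dx)\<^sup>2 F = ((k + 1 / 2) x + x\<^sup>2 / 4) F\<close>.
\<close>

definition euler_ldv :: "nat \<Rightarrow> real \<Rightarrow> real" where
  "euler_ldv k x = x * (poly (pderiv (laguerre_neg k)) x / poly (laguerre_neg k) x + 1 / 2)"

text \<open>For V = x F'/F one has x V' = (x d/dx)^2 F / F - V^2; Laguerre's equation supplies the
  first term.\<close>

lemma euler_ldv_riccati:
  assumes "x > 0"
  shows "(euler_ldv k has_real_derivative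
           ((real k + 1 / 2) * x + x ^ 2 / 4 - (euler_ldv k x) ^ 2) / x) (at x)"
proof -
  define q0 q1 q2 where "q0 = poly (laguerre_neg k) x" "q1 = poly (pderiv (laguerre_neg k)) x"
    "q2 = poly (pderiv (pderiv (laguerre_neg k))) x"
  have pos: "q0 > 0" using laguerre_neg_pos[of x k] assms by (simp add: q0_q1_q2_def)
  have ode: "x * q2 = real k * q0 - (1 + x) * q1"
    using laguerre_neg_ode[of x k] by (simp add: q0_q1_q2_def)
  have "(euler_ldv k has_real_derivative (q1 / q0 + 1 / 2 + x * ((q2 * q0 - q1 * q1) / (q0 * q0)))) (at x)"
    unfolding euler_ldv_def using pos
    by (auto intro!: derivative_eq_intros poly_DERIV simp: q0_q1_q2_def)
  moreover have "q1 / q0 + 1 / 2 + x * ((q2 * q0 - q1 * q1) / (q0 * q0)) =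
     ((real k + 1 / 2) * x + x ^ 2 / 4 - (euler_ldv k x) ^ 2) / x" (is "?l = ?r")
  proof -
    have "?l = q1 / q0 + 1 / 2 + ((x * q2) * q0 - x * q1 * q1) / (q0 * q0)" by (simp add: algebra_simps)
    also have "\<dots> = ?r"
      unfolding ode euler_ldv_def q0_q1_q2_def[symmetric] using pos assms
      by (simp add: field_simps power2_eq_square)
    finally show ?thesis .
  qed
  ultimately show ?thesis by simp
qed


text \<open>
  At \<open>x = laguerre_arg k u\<close> the potential \<open>(k + 1 / 2) x + x\<^sup>2 / 4\<close> is the square of
  \<open>S = wkb_rate k u\<close>, and \<open>x d/dx\<close> is \<open>(tanh u / 2) d/du\<close>. The WKB approximation of the
  logarithmic derivative is \<open>S - (x d/dx S) / (2 S) = S - wkb_correction u\<close>.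
\<close>

definition wkb_rate :: "nat \<Rightarrow> real \<Rightarrow> real" where
  "wkb_rate k u = (real k + 1 / 2) * sinh (2 * u)"

definition wkb_correction :: "real \<Rightarrow> real" where
  "wkb_correction u = 1 / 2 - 1 / (4 * (cosh u)\<^sup>2)"

definition laguerre_arg :: "nat \<Rightarrow> real \<Rightarrow> real" where
  "laguerre_arg k u = 4 * (real k + 1 / 2) * (sinh u)\<^sup>2"

definition ldv :: "nat \<Rightarrow> real \<Rightarrow> real" where
  "ldv k u = euler_ldv k (laguerre_arg k u)"

lemma wkb_rate_double: "wkb_rate k u = 2 * (real k + 1 / 2) * sinh u * cosh u"
  by (simp add: wkb_rate_def sinh_double)

lemma sinh_sq: "(sinh u)\<^sup>2 = (cosh u)\<^sup>2 - (1::real)"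
  using cosh_square_eq[of u] by simp

text \<open>The factor \<open>2 * cosh u / sinh u\<close> converts x d/dx into d/du and is kept
  apart in all these derivatives. Being positive, it drops out of the sign conditions of the
  barriers.\<close>

lemma has_real_derivative_wkb_rate:
  assumes "u > 0"
  shows "(wkb_rate k has_real_derivative
    2 * cosh u / sinh u * (2 * wkb_rate k u * wkb_correction u)) (at u)"
proof -
  have pos: "sinh u > 0" "cosh u > 0" using assms by (auto simp: cosh_real_pos)
  have "(wkb_rate k has_real_derivative (real k + 1 / 2) * (2 * cosh (2 * u))) (at u)"
    unfolding wkb_rate_def by (auto intro!: derivative_eq_intros)
  also have "cosh (2 * u) = 2 * (cosh u)\<^sup>2 - 1"
    by (simp add: cosh_double sinh_sq)
  also have "(real k + 1 / 2) * (2 * (2 * (cosh u)\<^sup>2 - 1)) =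
      2 * cosh u / sinh u * (2 * wkb_rate k u * wkb_correction u)"
    using pos by (simp add: wkb_rate_double wkb_correction_def field_simps power2_eq_square)
  finally show ?thesis .
qed

lemma has_real_derivative_wkb_correction:
  assumes "u > 0"
  shows "(wkb_correction has_real_derivative
    2 * cosh u / sinh u * ((sinh u)\<^sup>2 / (4 * cosh u ^ 4))) (at u)"
proof -
  have pos: "sinh u > 0" "cosh u > 0" using assms by (auto simp: cosh_real_pos)
  show ?thesis
    unfolding wkb_correction_def using pos
    by (auto intro!: derivative_eq_intros simp: field_simps power2_eq_square power4_eq_xxxx)
qed

lemma has_real_derivative_ldv:
  assumes "u > 0"
  shows "(ldv k has_real_derivative
    2 * cosh u / sinh u * ((wkb_rate k u)\<^sup>2 - (ldv k u)\<^sup>2)) (at u)"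
proof -
  define K where "K = real k + 1 / 2"
  have pos: "sinh u > 0" "cosh u > 0" "K > 0" using assms by (auto simp: cosh_real_pos K_def)
  define x where "x = laguerre_arg k u"
  have x: "x = 4 * K * (sinh u)\<^sup>2" by (simp add: x_def laguerre_arg_def K_def)
  have "x > 0" using pos by (simp add: x)
  have "(laguerre_arg k has_real_derivative 8 * K * sinh u * cosh u) (at u)"
    unfolding laguerre_arg_def K_def by (auto intro!: derivative_eq_intros)
  from DERIV_chain2[OF euler_ldv_riccati[OF \<open>x > 0\<close>, of k, unfolded x_def] this]
  have "(ldv k has_real_derivative
     ((K * x + x\<^sup>2 / 4 - (ldv k u)\<^sup>2) / x) * (8 * K * sinh u * cosh u)) (at u)"
    unfolding ldv_def x_def K_def .
  also have "K * x + x\<^sup>2 / 4 = (wkb_rate k u)\<^sup>2"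
  proof -
    have "K * x + x\<^sup>2 / 4 = 4 * K\<^sup>2 * (sinh u)\<^sup>2 * ((sinh u)\<^sup>2 + 1)"
      by (simp add: x power2_eq_square algebra_simps)
    also have "\<dots> = (2 * K * sinh u * cosh u)\<^sup>2" by (simp add: sinh_sq power_mult_distrib)
    finally show ?thesis by (simp add: wkb_rate_double K_def)
  qed
  also have "(((wkb_rate k u)\<^sup>2 - (ldv k u)\<^sup>2) / x) * (8 * K * sinh u * cosh u) =
     2 * cosh u / sinh u * ((wkb_rate k u)\<^sup>2 - (ldv k u)\<^sup>2)"
    unfolding x using pos by (simp add: field_simps power2_eq_square)
  finally show ?thesis .
qed

section \<open>Barriers for the logarithmic derivative\<close>

lemma cosh_sq_ge_1: "(cosh u)\<^sup>2 \<ge> (1::real)"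
  using cosh_real_ge_1[of u] by (simp add: one_le_power)

lemma wkb_correction_bounds: "1 / 4 \<le> wkb_correction u" "wkb_correction u \<le> 1 / 2"
  using cosh_sq_ge_1[of u] by (auto simp: wkb_correction_def field_simps)

text \<open>With S = \<open>wkb_rate k u\<close> and W = \<open>wkb_correction u\<close>, this
  quantity is, up to sign, what remains when S - W is inserted into the Riccati equation. It is free
  of \<open>k\<close>, so the bounds are uniform.\<close>

lemma wkb_residual_bounds:
  "0 \<le> (wkb_correction u)\<^sup>2 - (sinh u)\<^sup>2 / (4 * cosh u ^ 4)"
  "(wkb_correction u)\<^sup>2 - (sinh u)\<^sup>2 / (4 * cosh u ^ 4) \<le> 1 / 4"
proof -
  define y where "y = (cosh u)\<^sup>2"
  have y: "y \<ge> 1" using cosh_sq_ge_1 by (simp add: y_def)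
  have "cosh u ^ 4 = y\<^sup>2" by (simp add: y_def power2_eq_square power4_eq_xxxx)
  hence "(wkb_correction u)\<^sup>2 - (sinh u)\<^sup>2 / (4 * cosh u ^ 4) =
      (1 / 2 - 1 / (4 * y))\<^sup>2 - (y - 1) / (4 * y\<^sup>2)"
    by (simp add: wkb_correction_def sinh_sq y_def)
  also have "\<dots> = (4 * (y - 1)\<^sup>2 + 1) / (16 * y\<^sup>2)"
    using y by (simp add: field_simps power2_eq_square)
  finally have eq: "(wkb_correction u)\<^sup>2 - (sinh u)\<^sup>2 / (4 * cosh u ^ 4) =
    (4 * (y - 1)\<^sup>2 + 1) / (16 * y\<^sup>2)" .
  show "0 \<le> (wkb_correction u)\<^sup>2 - (sinh u)\<^sup>2 / (4 * cosh u ^ 4)"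
    unfolding eq by simp
  have "4 * (y - 1)\<^sup>2 + 1 \<le> 4 * y\<^sup>2"
    using y by (simp add: power2_eq_square algebra_simps)
  thus "(wkb_correction u)\<^sup>2 - (sinh u)\<^sup>2 / (4 * cosh u ^ 4) \<le> 1 / 4"
    unfolding eq using y by (simp add: field_simps)
qed

lemma continuous_on_ldv: "continuous_on {0..} (ldv k)"
proof -
  have "poly (laguerre_neg k) (laguerre_arg k u) \<noteq> 0" for u
    using laguerre_neg_pos[of "laguerre_arg k u" k] by (simp add: laguerre_arg_def)
  thus ?thesis
    unfolding ldv_def euler_ldv_def
    by (auto simp: laguerre_arg_def intro!: continuous_intros)
qed

lemma ldv_nonneg: "ldv k u \<ge> 0"
proof -
  have "laguerre_arg k u \<ge> 0" by (simp add: laguerre_arg_def)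
  thus ?thesis
    unfolding ldv_def euler_ldv_def
    by (intro mult_nonneg_nonneg add_nonneg_nonneg divide_nonneg_nonneg)
      (auto simp: pderiv_laguerre_neg_nonneg less_imp_le laguerre_neg_pos)
qed

lemma ldv_0: "ldv k 0 = 0"
  by (simp add: ldv_def euler_ldv_def laguerre_arg_def)

lemma wkb_rate_nonneg: "u \<ge> 0 \<Longrightarrow> wkb_rate k u \<ge> 0"
  by (simp add: wkb_rate_def)

lemma continuous_on_wkb: "continuous_on A (wkb_rate k)" "continuous_on A wkb_correction"
  unfolding wkb_rate_def wkb_correction_def using cosh_real_pos
  by (auto intro!: continuous_intros simp: less_imp_neq[symmetric])

text \<open>Where \<open>ldv\<close> exceeds \<open>wkb_rate\<close>, the Riccati equation makes
  \<open>ldv\<close> nonincreasing while \<open>wkb_rate\<close> is nondecreasing.\<close>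

lemma ldv_le:
  assumes "u \<ge> 0"
  shows "ldv k u \<le> wkb_rate k u"
proof -
  have "0 \<le> wkb_rate k u - ldv k u"
  proof (rule nonneg_by_barrier[OF _ _ DERIV_diff[OF has_real_derivative_wkb_rate has_real_derivative_ldv]])
    show "continuous_on {0..} (\<lambda>u. wkb_rate k u - ldv k u)"
      by (intro continuous_intros continuous_on_wkb continuous_on_ldv)
    fix t :: real assume t: "t > 0" "wkb_rate k t - ldv k t < 0"
    have "(wkb_rate k t)\<^sup>2 \<le> (ldv k t)\<^sup>2"
      using t wkb_rate_nonneg[of t k] by (intro power_mono) auto
    moreover have "2 * wkb_rate k t * wkb_correction t \<ge> 0"
      using t wkb_rate_nonneg[of t k] wkb_correction_bounds(1)[of t] by auto
    moreover have "2 * cosh t / sinh t \<ge> 0" using t by (simp add: cosh_real_nonneg)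
    ultimately show "0 \<le> 2 * cosh t / sinh t * (2 * wkb_rate k t * wkb_correction t) -
        2 * cosh t / sinh t * ((wkb_rate k t)\<^sup>2 - (ldv k t)\<^sup>2)"
      unfolding right_diff_distrib[symmetric] by (intro mult_nonneg_nonneg) linarith+
  qed (use assms in \<open>auto simp: ldv_0 wkb_rate_def\<close>)
  thus ?thesis by simp
qed

text \<open>Write V for \<open>ldv\<close>, and S, W for \<open>wkb_rate\<close> and
  \<open>wkb_correction\<close>. Where 0 <= V < S - 1, one has S^2 - V^2 >= 2S - 1, while S grows
  only at rate 2SW <= S; since S > 1 there, V catches up.\<close>

lemma ldv_ge:
  assumes "u \<ge> 0"
  shows "wkb_rate k u - 1 \<le> ldv k u"
proof -
  have "0 \<le> ldv k u - (wkb_rate k u - 1)"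
  proof (rule nonneg_by_barrier[where f = "\<lambda>u. ldv k u - (wkb_rate k u - 1)"])
    show "continuous_on {0..} (\<lambda>u. ldv k u - (wkb_rate k u - 1))"
      by (intro continuous_intros continuous_on_wkb continuous_on_ldv)
    show "((\<lambda>u. ldv k u - (wkb_rate k u - 1)) has_real_derivative
       2 * cosh t / sinh t * (((wkb_rate k t)\<^sup>2 - (ldv k t)\<^sup>2) - 2 * wkb_rate k t * wkb_correction t)) (at t)"
      if "t > 0" for t
      by (rule derivative_eq_intros has_real_derivative_wkb_rate has_real_derivative_ldv refl that)+
         (simp add: algebra_simps)
    fix t :: real assume t: "t > 0" "ldv k t - (wkb_rate k t - 1) < 0"
    define S V W where "S = wkb_rate k t" "V = ldv k t" "W = wkb_correction t"
    have V: "0 \<le> V" "V < S - 1" using t ldv_nonneg[of k t] by (auto simp: S_V_W_def)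
    have "V\<^sup>2 \<le> (S - 1)\<^sup>2" using V by (intro power_mono) auto
    hence "2 * S - 1 \<le> S\<^sup>2 - V\<^sup>2" by (simp add: power2_eq_square algebra_simps)
    moreover have "2 * S * W \<le> S"
      using V wkb_correction_bounds(2)[of t] mult_left_mono[of W "1/2" "2 * S"] by (auto simp: S_V_W_def)
    ultimately have "0 \<le> (S\<^sup>2 - V\<^sup>2) - 2 * S * W"
      using V by linarith
    moreover have "2 * cosh t / sinh t \<ge> 0" using t by (simp add: cosh_real_nonneg)
    ultimately show "0 \<le> 2 * cosh t / sinh t *
        (((wkb_rate k t)\<^sup>2 - (ldv k t)\<^sup>2) - 2 * wkb_rate k t * wkb_correction t)"
      unfolding S_V_W_def by (intro mult_nonneg_nonneg)
  qed (use assms in \<open>auto simp: ldv_0 wkb_rate_def\<close>)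
  thus ?thesis by simp
qed

text \<open>The weight S anticipates an error \<open>e\<close> of order 1/S and makes the product
  vanish at \<open>u = 0\<close>. The error alone obeys the equation with \<open>V + S - W\<close>;
  differentiating the weight turns this into \<open>V + S - 3 * W\<close>.\<close>

lemma has_real_derivative_ldv_error:
  fixes k t
  defines "S \<equiv> wkb_rate k t" and "V \<equiv> ldv k t" and "W \<equiv> wkb_correction t"
  defines "R \<equiv> W\<^sup>2 - (sinh t)\<^sup>2 / (4 * cosh t ^ 4)" and "e \<equiv> V - S + W"
  assumes "t > 0"
  shows "((\<lambda>u. wkb_rate k u * (ldv k u - wkb_rate k u + wkb_correction u)) has_real_derivative
    2 * cosh t / sinh t * (- (S * (R + e * (V + S - 3 * W))))) (at t)"
proof -
  have "((\<lambda>u. wkb_rate k u * (ldv k u - wkb_rate k u + wkb_correction u)) has_real_derivative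
     2 * cosh t / sinh t * (2 * S * W) * e +
     (2 * cosh t / sinh t * (S\<^sup>2 - V\<^sup>2) - 2 * cosh t / sinh t * (2 * S * W) +
      2 * cosh t / sinh t * (W\<^sup>2 - R)) * S) (at t)"
    unfolding assms(1-5)
    by (rule derivative_eq_intros has_real_derivative_wkb_rate has_real_derivative_ldv
          has_real_derivative_wkb_correction \<open>t > 0\<close> refl)+ simp
  also have "2 * cosh t / sinh t * (2 * S * W) * e +
     (2 * cosh t / sinh t * (S\<^sup>2 - V\<^sup>2) - 2 * cosh t / sinh t * (2 * S * W) +
      2 * cosh t / sinh t * (W\<^sup>2 - R)) * S =
     2 * cosh t / sinh t * (2 * S * W * e + (S\<^sup>2 - V\<^sup>2 - 2 * S * W + W\<^sup>2 - R) * S)"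
    by (simp add: ring_distribs mult.assoc)
  also have "2 * S * W * e + (S\<^sup>2 - V\<^sup>2 - 2 * S * W + W\<^sup>2 - R) * S = - (S * (R + e * (V + S - 3 * W)))"
    unfolding e_def by (simp add: power2_eq_square algebra_simps)
  finally show ?thesis .
qed

text \<open>
  Both bounds are barriers: wherever one is violated, the term \<open>e (V + S)\<close> of the Riccati equation
  for the error \<open>e\<close> dominates and drives the solution back; near \<open>u = 0\<close>, where \<open>S\<close> is small,
  \<open>ldv_le\<close> and \<open>ldv_ge\<close> suffice.
\<close>

lemma ldv_error:
  assumes "u \<ge> 0"
  shows "\<bar>wkb_rate k u * (ldv k u - wkb_rate k u + wkb_correction u)\<bar> \<le> 2"
proof -
  let ?E = "\<lambda>u. wkb_rate k u * (ldv k u - wkb_rate k u + wkb_correction u)"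
  have cont: "continuous_on {0..} ?E"
    by (intro continuous_intros continuous_on_wkb continuous_on_ldv)
  have E0: "?E 0 = 0" by (simp add: wkb_rate_def)
  have "0 \<le> 2 - ?E u"
  proof (rule nonneg_by_barrier[OF _ _ DERIV_diff[OF DERIV_const has_real_derivative_ldv_error]])
    show "continuous_on {0..} (\<lambda>u. 2 - ?E u)" by (intro continuous_intros cont)
    fix t :: real assume t: "t > 0" "2 - ?E t < 0"
    define S V W e where "S = wkb_rate k t" "V = ldv k t" "W = wkb_correction t" "e = V - S + W"
    define R where "R = W\<^sup>2 - (sinh t)\<^sup>2 / (4 * cosh t ^ 4)"
    have R: "0 \<le> R" using wkb_residual_bounds[of t] by (simp add: R_def S_V_W_e_def)
    have W: "W \<le> 1 / 2" using wkb_correction_bounds[of t] by (simp add: S_V_W_e_def)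
    have V: "S - 1 \<le> V" "V \<le> S" "0 \<le> S"
      using t ldv_le[of t k] ldv_ge[of t k] wkb_rate_nonneg[of t k] by (auto simp: S_V_W_e_def)
    have Se: "2 < S * e" using t by (simp add: S_V_W_e_def)
    have e: "e \<le> 1 / 2" using V W by (simp add: S_V_W_e_def)
    have "0 < S * e" using Se by linarith
    hence "e > 0" using V(3) by (simp add: zero_less_mult_iff)
    \<comment> \<open>A violation of the upper bound cannot occur for small S, as
      \<open>e \<le> 1 / 2\<close>. For S > 4 both R and \<open>e * (V + S - 3 * W)\<close> are
      nonnegative.\<close>
    have "S > 4" using Se mult_left_mono[OF e V(3)] by simp
    have "V + S - 3 * W \<ge> 0" using V W \<open>S > 4\<close> by linarith
    hence "0 \<le> S * (R + e * (V + S - 3 * W))" using R \<open>e > 0\<close> V by auto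
    moreover have "2 * cosh t / sinh t \<ge> 0" using t by (simp add: cosh_real_nonneg)
    ultimately have "0 \<le> 2 * cosh t / sinh t * (S * (R + e * (V + S - 3 * W)))"
      by (rule mult_nonneg_nonneg[rotated])
    thus "0 \<le> 0 - 2 * cosh t / sinh t * (- (wkb_rate k t * ((wkb_correction t)\<^sup>2 - (sinh t)\<^sup>2 / (4 * cosh t ^ 4) +
      (ldv k t - wkb_rate k t + wkb_correction t) * (ldv k t + wkb_rate k t - 3 * wkb_correction t))))"
      unfolding R_def S_V_W_e_def by simp
  qed (use assms E0 in auto)
  moreover have "0 \<le> ?E u + 2"
  proof (rule nonneg_by_barrier[OF _ _ DERIV_add[OF has_real_derivative_ldv_error DERIV_const]])
    show "continuous_on {0..} (\<lambda>u. ?E u + 2)" by (intro continuous_intros cont)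
    fix t :: real assume t: "t > 0" "?E t + 2 < 0"
    define S V W e where "S = wkb_rate k t" "V = ldv k t" "W = wkb_correction t" "e = V - S + W"
    define R where "R = W\<^sup>2 - (sinh t)\<^sup>2 / (4 * cosh t ^ 4)"
    have R: "R \<le> 1 / 4" using wkb_residual_bounds[of t] by (simp add: R_def S_V_W_e_def)
    have W: "1 / 4 \<le> W" "W \<le> 1 / 2" using wkb_correction_bounds[of t] by (auto simp: S_V_W_e_def)
    have V: "S - 1 \<le> V" "V \<le> S" "0 \<le> S"
      using t ldv_le[of t k] ldv_ge[of t k] wkb_rate_nonneg[of t k] by (auto simp: S_V_W_e_def)
    have "S * e < - 2" using t unfolding S_V_W_e_def by linarith
    hence Se: "S * (- e) > 2" by simp
    have e: "- e \<le> 3 / 4" using V W by (simp add: S_V_W_e_def)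
    have "S > 2" using Se mult_left_mono[OF e V(3)] by simp
    have "0 < S * (- e)" using Se by linarith
    hence "- e > 0" using V(3) unfolding zero_less_mult_iff by linarith
    \<comment> \<open>The left-hand bounds give V + S - 3W >= 2S - 5/2, which is at least 3S/4 once
      S >= 2. Combined with \<open>S * (- e) > 2\<close> the restoring term exceeds 3/2, more than
      the residual R <= 1/4.\<close>
    have "S * (3 / 4) \<le> V + S - 3 * W" using V W \<open>S > 2\<close> by linarith
    hence "(- e) * (S * (3 / 4)) \<le> (- e) * (V + S - 3 * W)" using \<open>- e > 0\<close> by (intro mult_left_mono) auto
    hence "0 \<le> - (R + e * (V + S - 3 * W))" using R Se by (simp add: algebra_simps)
    hence "0 \<le> S * - (R + e * (V + S - 3 * W))" using V by (intro mult_nonneg_nonneg)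
    moreover have "2 * cosh t / sinh t \<ge> 0" using t by (simp add: cosh_real_nonneg)
    ultimately have "0 \<le> 2 * cosh t / sinh t * (S * - (R + e * (V + S - 3 * W)))"
      by (rule mult_nonneg_nonneg[rotated])
    thus "0 \<le> 2 * cosh t / sinh t * (- (wkb_rate k t * ((wkb_correction t)\<^sup>2 - (sinh t)\<^sup>2 / (4 * cosh t ^ 4) +
      (ldv k t - wkb_rate k t + wkb_correction t) * (ldv k t + wkb_rate k t - 3 * wkb_correction t)))) + 0"
      unfolding R_def S_V_W_e_def by (simp only: mult_minus_right add_0_right)
  qed (use assms E0 in auto)
  ultimately show ?thesis by (simp add: abs_le_iff)
qed

section \<open>Integration of the logarithmic derivative from infinity\<close>

text \<open>
  The logarithm of \<open>exp (x / 2) L\<^sub>k(-x)\<close> relative to its WKB approximation, up to a constant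
  which is identified in the limit \<open>u \<rightarrow> \<infinity>\<close>, where only the leading coefficient of
  \<open>L\<^sub>k\<close> matters.
\<close>

definition log_defect :: "nat \<Rightarrow> real \<Rightarrow> real" where
  "log_defect k u = ln (poly (laguerre_neg k) (laguerre_arg k u)) + laguerre_arg k u / 2
     - (real k + 1 / 2) * (2 * u + sinh (2 * u)) + ln (sinh (2 * u)) / 2"

text \<open>Under x d/dx the logarithm of exp(x/2) L_k(-x) gives \<open>ldv\<close>, the exponent
  k_1 (2u + sinh 2u) gives \<open>wkb_rate\<close>, and half the logarithm of sinh 2u gives
  \<open>wkb_correction\<close>.\<close>

lemma has_real_derivative_log_defect:
  assumes "u > 0"
  shows "(log_defect k has_real_derivative
    2 * cosh u / sinh u * (ldv k u - wkb_rate k u + wkb_correction u)) (at u)"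
proof -
  define K where "K = real k + 1 / 2"
  have pos: "sinh u > 0" "cosh u > 0" "K > 0" using assms by (auto simp: cosh_real_pos K_def)
  define x where "x = laguerre_arg k u"
  have x: "x = 4 * K * (sinh u)\<^sup>2" by (simp add: x_def laguerre_arg_def K_def)
  have qpos: "poly (laguerre_neg k) x > 0"
    using pos by (intro laguerre_neg_pos) (simp add: x)
  have dx: "(laguerre_arg k has_real_derivative 8 * K * sinh u * cosh u) (at u)"
    unfolding laguerre_arg_def K_def by (auto intro!: derivative_eq_intros)
  have dq: "((\<lambda>u. poly (laguerre_neg k) (laguerre_arg k u)) has_real_derivative
      poly (pderiv (laguerre_neg k)) x * (8 * K * sinh u * cosh u)) (at u)"
    using DERIV_chain2[OF poly_DERIV dx] by (simp add: x_def)
  have "(log_defect k has_real_derivative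
      poly (pderiv (laguerre_neg k)) x * (8 * K * sinh u * cosh u) / poly (laguerre_neg k) x +
      8 * K * sinh u * cosh u / 2 - K * (2 + 2 * cosh (2 * u)) +
      (2 * cosh (2 * u) / sinh (2 * u)) / 2) (at u)"
    unfolding log_defect_def using assms qpos
    by (auto intro!: derivative_eq_intros dx dq simp: x_def K_def divide_simps)
  also have "poly (pderiv (laguerre_neg k)) x * (8 * K * sinh u * cosh u) / poly (laguerre_neg k) x +
      8 * K * sinh u * cosh u / 2 = 2 * cosh u / sinh u * ldv k u"
    unfolding ldv_def euler_ldv_def x_def[symmetric]
    using pos qpos by (simp add: x field_simps power2_eq_square)
  also have "2 * cosh u / sinh u * ldv k u - K * (2 + 2 * cosh (2 * u)) +
      (2 * cosh (2 * u) / sinh (2 * u)) / 2 =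
      2 * cosh u / sinh u * (ldv k u - wkb_rate k u + wkb_correction u)"
    using pos unfolding wkb_rate_double wkb_correction_def K_def[symmetric] sinh_double cosh_double sinh_sq
    by (simp add: field_simps power2_eq_square)
  finally show ?thesis .
qed

text \<open>Dividing the bound on S e by S = 2 k_1 sinh u cosh u cancels the cosh and leaves
  1/sinh^2, the derivative of -coth.\<close>

lemma log_defect_deriv_bound:
  assumes "u > 0"
  shows "\<bar>2 * cosh u / sinh u * (ldv k u - wkb_rate k u + wkb_correction u)\<bar> \<le>
    2 / (real k + 1 / 2) * (1 / (sinh u)\<^sup>2)"
proof -
  define K where "K = real k + 1 / 2"
  have pos: "sinh u > 0" "cosh u > 0" "K > 0" using assms by (auto simp: cosh_real_pos K_def)
  define e where "e = ldv k u - wkb_rate k u + wkb_correction u"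
  have S: "wkb_rate k u = 2 * K * sinh u * cosh u" by (simp add: wkb_rate_double K_def)
  have "\<bar>wkb_rate k u * e\<bar> \<le> 2" using ldv_error[of u k] assms by (simp add: e_def)
  hence "2 * K * sinh u * cosh u * \<bar>e\<bar> \<le> 2" using pos by (simp add: S abs_mult)
  hence "(2 * K * sinh u * cosh u * \<bar>e\<bar>) / (K * (sinh u)\<^sup>2) \<le> 2 / (K * (sinh u)\<^sup>2)"
    using pos by (intro divide_right_mono) auto
  also have "(2 * K * sinh u * cosh u * \<bar>e\<bar>) / (K * (sinh u)\<^sup>2) = \<bar>2 * cosh u / sinh u * e\<bar>"
    using pos by (simp add: abs_mult power2_eq_square)
  finally show ?thesis by (simp add: e_def K_def)
qed

lemma degree_laguerre_neg: "degree (laguerre_neg k) = k"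
proof (rule antisym)
  show "degree (laguerre_neg k) \<le> k"
    by (rule degree_le) (auto simp: coeff_laguerre_neg binomial_eq_0)
  show "k \<le> degree (laguerre_neg k)"
    by (rule le_degree) (simp add: coeff_laguerre_neg)
qed

text \<open>The growing terms are grouped into four convergent pieces: L_k(-x)/x^k tends to 1/k!, ln
  x - 2u to ln K, x/2 - K sinh 2u to -K, and ln(sinh 2u)/2 - u to -(ln 2)/2. Their sum is rewritten
  through \<open>stirling_defect\<close>.\<close>

lemma log_defect_tendsto:
  "(log_defect k \<longlongrightarrow> stirling_defect k - ln (4 * pi * (real k + 1 / 2)) / 2) at_top"
proof -
  define K where "K = real k + 1 / 2"
  have K: "K > 0" by (simp add: K_def)
  have x: "laguerre_arg k = (\<lambda>u. 4 * K * (sinh u)\<^sup>2)"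
    by (simp add: laguerre_arg_def K_def fun_eq_iff)
  have x_top: "filterlim (laguerre_arg k) at_top at_top"
    unfolding x using K by real_asymp
  have "((\<lambda>x. poly (laguerre_neg k) x / x ^ k) \<longlongrightarrow> 1 / fact k) at_infinity"
    using poly_divide_tendsto_aux[of "laguerre_neg k"]
    by (simp add: degree_laguerre_neg coeff_laguerre_neg)
  hence "((\<lambda>u. poly (laguerre_neg k) (laguerre_arg k u) / laguerre_arg k u ^ k) \<longlongrightarrow> 1 / fact k) at_top"
    by (rule filterlim_compose) (rule filterlim_mono[OF x_top at_top_le_at_infinity order_refl])
  hence lim1: "((\<lambda>u. ln (poly (laguerre_neg k) (laguerre_arg k u) / laguerre_arg k u ^ k)) \<longlongrightarrow> ln (1 / fact k)) at_top"
    by (rule tendsto_ln) simp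
  have "((\<lambda>u. ln (4 * K * (sinh u)\<^sup>2) - 2 * u) \<longlongrightarrow> ln (4 * K * (1 / 2)\<^sup>2)) at_top"
    using K by real_asymp
  hence lim2: "((\<lambda>u. ln (4 * K * (sinh u)\<^sup>2) - 2 * u) \<longlongrightarrow> ln K) at_top"
    by (simp add: power2_eq_square)
  have lim3: "((\<lambda>u. K * (cosh (2 * u) - 1 - sinh (2 * u))) \<longlongrightarrow> - K) at_top"
    using K by real_asymp
  have "((\<lambda>u::real. ln (sinh (2 * u)) / 2 - u) \<longlongrightarrow> ln (1 / 2) / 2) at_top"
    by real_asymp
  hence lim4: "((\<lambda>u::real. ln (sinh (2 * u)) / 2 - u) \<longlongrightarrow> - ln 2 / 2) at_top"
    by (simp add: ln_div)
  have "((\<lambda>u. ln (poly (laguerre_neg k) (laguerre_arg k u) / laguerre_arg k u ^ k) +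
      real k * (ln (4 * K * (sinh u)\<^sup>2) - 2 * u) + K * (cosh (2 * u) - 1 - sinh (2 * u)) +
      (ln (sinh (2 * u)) / 2 - u)) \<longlongrightarrow> ln (1 / fact k) + real k * ln K + - K + - ln 2 / 2) at_top"
    by (intro tendsto_intros lim1 lim2 lim3 lim4)
  also have "ln (1 / fact k) + real k * ln K + - K + - ln 2 / 2 =
      stirling_defect k - ln (4 * pi * (real k + 1 / 2)) / 2"
  proof -
    have "ln (4 :: real) = 2 * ln 2" using ln_realpow[of 2 2] by simp
    moreover have "real k * ln K = K * ln K - ln K / 2" by (simp add: K_def algebra_simps)
    ultimately show ?thesis
      unfolding stirling_defect_def K_def[symmetric] using K
      by (simp add: ln_div ln_mult algebra_simps add_divide_distrib)
  qed
  finally show ?thesis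
  proof (rule Lim_transform_eventually)
    show "\<forall>\<^sub>F u in at_top. ln (poly (laguerre_neg k) (laguerre_arg k u) / laguerre_arg k u ^ k) +
      real k * (ln (4 * K * (sinh u)\<^sup>2) - 2 * u) + K * (cosh (2 * u) - 1 - sinh (2 * u)) +
      (ln (sinh (2 * u)) / 2 - u) = log_defect k u"
      using eventually_gt_at_top[of 0]
    proof eventually_elim
      case (elim u)
      have xp: "laguerre_arg k u > 0" using elim K by (simp add: x)
      have "ln (poly (laguerre_neg k) (laguerre_arg k u) / laguerre_arg k u ^ k) =
         ln (poly (laguerre_neg k) (laguerre_arg k u)) - real k * ln (4 * K * (sinh u)\<^sup>2)"
        using xp laguerre_neg_pos[of "laguerre_arg k u" k] unfolding x
        by (subst ln_div) (auto simp: ln_realpow)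
      moreover have "laguerre_arg k u / 2 = K * (cosh (2 * u) - 1)"
        by (simp add: x cosh_double sinh_sq)
      moreover have "real k * (2 * u) = (K - 1 / 2) * (2 * u)"
        by (simp add: K_def)
      ultimately show ?case
        unfolding log_defect_def K_def[symmetric] by (simp add: algebra_simps)
    qed
  qed
qed

lemma DERIV_coth:
  assumes "u > (0::real)"
  shows "((\<lambda>u. cosh u / sinh u) has_real_derivative - (1 / (sinh u)\<^sup>2)) (at u)"
proof -
  have pos: "sinh u > 0" using assms by auto
  have "((\<lambda>u. cosh u / sinh u) has_real_derivative ((sinh u)\<^sup>2 - (cosh u)\<^sup>2) / (sinh u)\<^sup>2) (at u)"
    using pos by (auto intro!: derivative_eq_intros simp: power2_eq_square)
  thus ?thesis by (simp add: cosh_square_eq)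
qed

text \<open>The left side equals 2/(exp(2u) - 1), and exp(2u) - 1 >= 2u.\<close>

lemma coth_minus_1_le:
  assumes "u > (0::real)"
  shows "cosh u / sinh u - 1 \<le> 1 / u"
proof -
  have pos: "sinh u > 0" using assms by auto
  have e: "2 * u \<le> exp (2 * u) - 1" using exp_ge_add_one_self[of "2 * u"] by linarith
  have "cosh u - sinh u = exp (- u)" by (simp add: cosh_minus_sinh)
  moreover have "u * exp (- u) \<le> sinh u"
  proof -
    have "2 * u * exp (- u) \<le> (exp (2 * u) - 1) * exp (- u)"
      using e by (intro mult_right_mono) auto
    also have "\<dots> = 2 * sinh u" by (simp add: sinh_field_def algebra_simps flip: exp_add)
    finally show ?thesis by simp
  qed
  ultimately have "u * (cosh u - sinh u) \<le> sinh u" by simp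
  thus ?thesis using pos assms by (simp add: field_simps)
qed

text \<open>By the derivative bound, adding (2/K) coth makes \<open>log_defect\<close> nonincreasing
  and subtracting it makes \<open>log_defect\<close> nondecreasing. Comparing each with its limit at
  infinity replaces an integral.\<close>

lemma log_defect_bound:
  assumes "u > 0"
  shows "\<bar>log_defect k u - (stirling_defect k - ln (4 * pi * (real k + 1 / 2)) / 2)\<bar> \<le>
    2 / ((real k + 1 / 2) * u)"
proof -
  define K where "K = real k + 1 / 2"
  have K: "K > 0" by (simp add: K_def)
  define l where "l = stirling_defect k - ln (4 * pi * (real k + 1 / 2)) / 2"
  have lim: "((\<lambda>t. log_defect k t + c * (cosh t / sinh t)) \<longlongrightarrow> l + c * 1) at_top" for c
  proof -
    have "((\<lambda>t::real. cosh t / sinh t) \<longlongrightarrow> 1) at_top" by real_asymp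
    thus ?thesis unfolding l_def by (intro tendsto_intros log_defect_tendsto)
  qed
  have der: "((\<lambda>t. log_defect k t + c * (cosh t / sinh t)) has_real_derivative
      2 * cosh t / sinh t * (ldv k t - wkb_rate k t + wkb_correction t) + c * (- (1 / (sinh t)\<^sup>2))) (at t)"
    if "t > 0" for t c
    by (intro DERIV_add DERIV_cmult DERIV_coth has_real_derivative_log_defect that)
  have "log_defect k t + 2 / K * (cosh t / sinh t) \<le> log_defect k u + 2 / K * (cosh u / sinh u)" if "u \<le> t" for t
    using that
  proof (rule DERIV_nonpos_imp_nonincreasing)
    fix z assume "u \<le> z"
    hence "z > 0" using assms by simp
    with der[of z "2 / K"] log_defect_deriv_bound[of z k]
    show "\<exists>y. ((\<lambda>t. log_defect k t + 2 / K * (cosh t / sinh t)) has_real_derivative y) (at z) \<and> y \<le> 0"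
      by (intro exI conjI) (assumption, unfold K_def abs_le_iff, linarith)
  qed
  hence "\<forall>\<^sub>F t in at_top. log_defect k t + 2 / K * (cosh t / sinh t) \<le> log_defect k u + 2 / K * (cosh u / sinh u)"
    by (rule eventually_mono[OF eventually_ge_at_top])
  from tendsto_upperbound[OF lim this]
  have 1: "l + 2 / K \<le> log_defect k u + 2 / K * (cosh u / sinh u)" by simp
  have "log_defect k u + (- 2 / K) * (cosh u / sinh u) \<le> log_defect k t + (- 2 / K) * (cosh t / sinh t)" if "u \<le> t" for t
    using that
  proof (rule DERIV_nonneg_imp_nondecreasing)
    fix z assume "u \<le> z"
    hence "z > 0" using assms by simp
    with der[of z "- 2 / K"] log_defect_deriv_bound[of z k]
    show "\<exists>y. ((\<lambda>t. log_defect k t + (- 2 / K) * (cosh t / sinh t)) has_real_derivative y) (at z) \<and> 0 \<le> y"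
      by (intro exI conjI) (assumption, unfold K_def abs_le_iff, linarith)
  qed
  hence "\<forall>\<^sub>F t in at_top. log_defect k u + (- 2 / K) * (cosh u / sinh u) \<le> log_defect k t + (- 2 / K) * (cosh t / sinh t)"
    by (rule eventually_mono[OF eventually_ge_at_top])
  from tendsto_lowerbound[OF lim this]
  have 2: "log_defect k u + (- 2 / K) * (cosh u / sinh u) \<le> l + (- 2 / K)" by simp
  have "\<bar>log_defect k u - l\<bar> \<le> 2 / K * (cosh u / sinh u - 1)"
    using 1 2 by (simp add: abs_le_iff right_diff_distrib)
  also have "\<dots> \<le> 2 / K * (1 / u)"
    using K coth_minus_1_le[OF assms] by (intro mult_left_mono) auto
  finally show ?thesis by (simp add: l_def K_def)
qed

section \<open>From logarithmic to relative error\<close>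

lemma abs_exp_minus_1_le:
  fixes d :: real
  shows "\<bar>exp d - 1\<bar> \<le> \<bar>d\<bar> * exp \<bar>d\<bar>"
proof (cases "d \<ge> 0")
  case True
  have "exp d * (1 - d) \<le> exp d * exp (- d)"
    using exp_ge_add_one_self[of "- d"] by (intro mult_left_mono) auto
  hence "exp d * (1 - d) \<le> 1" by (simp flip: exp_add)
  thus ?thesis using True by (simp add: algebra_simps)
next
  case False
  hence "\<bar>exp d - 1\<bar> \<le> \<bar>d\<bar> * 1"
    using exp_ge_add_one_self[of d] exp_le_one_iff[of d] unfolding abs_le_iff by linarith
  also have "\<dots> \<le> \<bar>d\<bar> * exp \<bar>d\<bar>" by (intro mult_left_mono) auto
  finally show ?thesis .
qed

text \<open>\<delta> is the distance of \<open>log_defect\<close> from its limit plus the Stirling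
  defect, and the two terms of the bound are the estimates for these.\<close>

lemma l2_onorm_spectral_proj_wkb:
  fixes k :: nat and u k1 :: real
  defines "k1 \<equiv> real k + 1 / 2"
  assumes "u > 0"
  obtains \<delta> where "\<bar>\<delta>\<bar> \<le> 2 / (k1 * u) + 1 / (4 * k1)"
    "l2_onorm (spectral_proj (sqrt (2 * k1) * sinh u) k) =
       (4 * pi * k1 * sinh (2 * u)) powr (- (1 / 2)) * exp (k1 * (2 * u + sinh (2 * u))) * exp \<delta>"
proof
  define x where "x = laguerre_arg k u"
  define a where "a = sqrt (2 * k1) * sinh u"
  define \<delta> where "\<delta> = log_defect k u + ln (4 * pi * k1) / 2"
  have pos: "k1 > 0" "sinh (2 * u) > 0" using assms by (auto simp: k1_def)
  have "x \<ge> 0" by (simp add: x_def laguerre_arg_def)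
  hence q: "poly (laguerre_neg k) x > 0" by (rule laguerre_neg_pos)
  show "\<bar>\<delta>\<bar> \<le> 2 / (k1 * u) + 1 / (4 * k1)"
    using log_defect_bound[OF \<open>u > 0\<close>, of k] stirling_defect_bound[of k]
    unfolding \<delta>_def k1_def by linarith
  have a2: "a\<^sup>2 = x / 2"
    using pos by (simp add: a_def x_def laguerre_arg_def k1_def power_mult_distrib)
  have "l2_onorm (spectral_proj a k) = exp (x / 2) * poly (laguerre_neg k) x"
    unfolding l2_onorm_spectral_proj a2 by (simp add: poly_laguerre_neg)
  also have "\<dots> = exp (x / 2 + ln (poly (laguerre_neg k) x))"
    using q by (simp add: exp_add)
  also have "x / 2 + ln (poly (laguerre_neg k) x) =
      - (1 / 2) * ln (4 * pi * k1 * sinh (2 * u)) + k1 * (2 * u + sinh (2 * u)) + \<delta>"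
  proof -
    have "ln (4 * pi * k1 * sinh (2 * u)) = ln (4 * pi * k1) + ln (sinh (2 * u))"
      using pos by (intro ln_mult_pos) auto
    thus ?thesis
      by (simp add: \<delta>_def log_defect_def x_def k1_def add_divide_distrib)
  qed
  also have "exp \<dots> = (4 * pi * k1 * sinh (2 * u)) powr (- (1 / 2)) * exp (k1 * (2 * u + sinh (2 * u))) * exp \<delta>"
    using pos unfolding exp_add by (simp add: powr_def)
  finally show "l2_onorm (spectral_proj (sqrt (2 * k1) * sinh u) k) =
     (4 * pi * k1 * sinh (2 * u)) powr (- (1 / 2)) * exp (k1 * (2 * u + sinh (2 * u))) * exp \<delta>"
    unfolding a_def .
qed

theorem theorem5p2:
  fixes p1 p2 :: real
  assumes "p1 > 0" and "p2 > 0" and "p1 + p2 < 1 / 2"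
  shows "\<exists>K>0. \<exists>C>0. \<forall>(k::nat) (u::real) (k1::real).
           real k \<ge> K \<longrightarrow> k1 = real k + 1 / 2 \<longrightarrow>
           3 / 8 * k1 powr (- 2 * p2) \<le> u \<longrightarrow> u \<le> p2 * ln k1 \<longrightarrow>
           (\<exists>\<epsilon>::real. \<bar>\<epsilon>\<bar> \<le> C * k1 powr (- p1) \<and>
              l2_onorm (spectral_proj (sqrt (2 * k1) * sinh u) k) =
                (4 * pi * k1 * sinh (2 * u)) powr (- (1 / 2)) *
                exp (k1 * (2 * u + sinh (2 * u))) * (1 + \<epsilon>))"
\<comment> \<open>K = 1 ensures \<open>k1 \<ge> 1\<close>, so powers of \<open>k1\<close> increase
  with the exponent. The constant is 6 exp 6 because |\<delta>| is at most (16/3 + 1/4) times the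
  power, hence at most 6 times it and at most 6, and |exp \<delta> - 1| <= |\<delta>| exp
  |\<delta>|.\<close>
proof (rule exI[of _ 1], rule conjI[OF zero_less_one], rule exI[of _ "6 * exp 6"], intro conjI allI impI)
  fix k :: nat and u k1 :: real
  assume k: "real k \<ge> 1" and k1: "k1 = real k + 1 / 2"
    and u: "3 / 8 * k1 powr (- 2 * p2) \<le> u"
  have k1_ge: "k1 \<ge> 1" using k k1 by simp
  hence u_low: "3 / 8 * k1 powr (- 2 * p2) > 0" by simp
  hence "u > 0" using u by linarith
  then obtain \<delta> where \<delta>: "\<bar>\<delta>\<bar> \<le> 2 / (k1 * u) + 1 / (4 * k1)"
    and norm: "l2_onorm (spectral_proj (sqrt (2 * k1) * sinh u) k) =
       (4 * pi * k1 * sinh (2 * u)) powr (- (1 / 2)) * exp (k1 * (2 * u + sinh (2 * u))) * exp \<delta>"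
    unfolding k1 by (rule l2_onorm_spectral_proj_wkb)
  have "2 / (k1 * u) \<le> 2 / (k1 * (3 / 8 * k1 powr (- 2 * p2)))"
    using u u_low \<open>u > 0\<close> k1_ge by (intro divide_left_mono mult_left_mono mult_pos_pos) auto
  also have "\<dots> = 16 / 3 * (k1 powr (2 * p2) * k1 powr (- 1))"
    using k1_ge by (simp add: powr_minus field_simps)
  also have "\<dots> = 16 / 3 * k1 powr (2 * p2 - 1)"
    unfolding powr_add[symmetric] by simp
  \<comment> \<open>\<open>2 * p2 - 1 \<le> - p1\<close> holds because p1 + p2 and p2 are both below
    1/2.\<close>
  also have "\<dots> \<le> 16 / 3 * k1 powr (- p1)"
    using k1_ge assms by (intro mult_left_mono powr_mono) auto
  finally have 1: "2 / (k1 * u) \<le> 16 / 3 * k1 powr (- p1)" .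
  have "1 / (4 * k1) = 1 / 4 * k1 powr (- 1)"
    using k1_ge by (simp add: powr_minus field_simps)
  also have "\<dots> \<le> 1 / 4 * k1 powr (- p1)"
    using k1_ge assms by (intro mult_left_mono powr_mono) auto
  finally have \<delta>_le: "\<bar>\<delta>\<bar> \<le> 6 * k1 powr (- p1)"
    using 1 \<delta> powr_ge_zero[of k1 "- p1"] by linarith
  have "k1 powr (- p1) \<le> k1 powr 0" using k1_ge assms by (intro powr_mono) auto
  hence "\<bar>\<delta>\<bar> \<le> 6" using \<delta>_le k1_ge by simp
  have "\<bar>exp \<delta> - 1\<bar> \<le> \<bar>\<delta>\<bar> * exp \<bar>\<delta>\<bar>" by (rule abs_exp_minus_1_le)
  also have "\<dots> \<le> (6 * k1 powr (- p1)) * exp 6"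
    using \<delta>_le \<open>\<bar>\<delta>\<bar> \<le> 6\<close> by (intro mult_mono) auto
  finally have "\<bar>exp \<delta> - 1\<bar> \<le> 6 * exp 6 * k1 powr (- p1)" by (simp add: mult_ac)
  thus "\<exists>\<epsilon>::real. \<bar>\<epsilon>\<bar> \<le> 6 * exp 6 * k1 powr (- p1) \<and>
      l2_onorm (spectral_proj (sqrt (2 * k1) * sinh u) k) =
        (4 * pi * k1 * sinh (2 * u)) powr (- (1 / 2)) * exp (k1 * (2 * u + sinh (2 * u))) * (1 + \<epsilon>)"
    unfolding norm by (intro exI[of _ "exp \<delta> - 1"]) simp
qed auto

end
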